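(* If $0<k<n$, then the boundary of the $k$-numerical range $W_k(c)$ consists of (i.e. is the union of) a finite number of line segments and curved real analytic arcs.
   Context: $c$ is a linear operator on an $n$-dimensional complex Hilbert space $H$. The $k$-numerical range of $c$ is the compact convex set $W_k(c)=\left\{\frac1k\sum_{i=1}^k\langle c\mathbf{x}_i,\mathbf{x}_i\rangle:\ \mathbf{x}_1,\dots,\mathbf{x}_k\in H \text{ orthonormal}\right\}\subset\mathbb{C}\cong\mathbb{R}^2$. Line segments may be degenerate (single points). A curved real analytic arc is the image of an interval under a nonconstant real analytic map into $\mathbb{R}^2$, which contains no nondegenerate line segment. *)

theory Defs
  imports "HOL-Analysis.Analysis"
begin

text \<open>
  A finite-dimensional complex Hilbert space, given by its scalar multiplication and its inner
  product, which is linear in the first argument and conjugate linear in the second.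
  Completeness is automatic in finite dimension, hence it is not listed as an axiom.
\<close>

locale fin_dim_complex_hilbert_space = vector_space scale
  for scale :: "complex \<Rightarrow> 'a::ab_group_add \<Rightarrow> 'a" +
  fixes ip :: "'a \<Rightarrow> 'a \<Rightarrow> complex"
  assumes ip_add_left: "ip (x + y) z = ip x z + ip y z"
    and ip_scale_left: "ip (scale a x) y = a * ip x y"
    and ip_commute: "ip x y = cnj (ip y x)"
    and ip_self_nonneg: "0 \<le> Re (ip x x)"
    and ip_self_eq_0: "ip x x = 0 \<Longrightarrow> x = 0"
    and finite_spanning: "\<exists>B. finite B \<and> span B = UNIV"

definition orthonormal_family :: "('a \<Rightarrow> 'a \<Rightarrow> complex) \<Rightarrow> nat \<Rightarrow> (nat \<Rightarrow> 'a) \<Rightarrow> bool" where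
  "orthonormal_family ip k x \<longleftrightarrow> (\<forall>i<k. \<forall>j<k. ip (x i) (x j) = (if i = j then 1 else 0))"

definition numerical_range ::
    "('a \<Rightarrow> 'a \<Rightarrow> complex) \<Rightarrow> nat \<Rightarrow> ('a \<Rightarrow> 'a) \<Rightarrow> complex set" where
  "numerical_range ip k c =
     {(1 / of_nat k) * (\<Sum>i<k. ip (c (x i)) (x i)) | x. orthonormal_family ip k x}"

text \<open>
  The power series is compared with the map only inside the interval; at an endpoint belonging
  to a nondegenerate interval this says that the map extends analytically beyond the endpoint.
\<close>

definition real_analytic_on :: "(real \<Rightarrow> 'b::real_normed_vector) \<Rightarrow> real set \<Rightarrow> bool" where
  "real_analytic_on f I \<longleftrightarrow>
     (\<forall>t\<in>I. \<exists>r>0. \<exists>a. \<forall>s\<in>I. \<bar>s - t\<bar> < r \<longrightarrow> (\<lambda>m. (s - t) ^ m *\<^sub>R a m) sums f s)"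

definition line_segment :: "complex set \<Rightarrow> bool" where
  "line_segment S \<longleftrightarrow> (\<exists>a b. S = closed_segment a b)"

definition curved_real_analytic_arc :: "complex set \<Rightarrow> bool" where
  "curved_real_analytic_arc S \<longleftrightarrow>
     (\<exists>f I. is_interval I \<and> real_analytic_on f I \<and> \<not> f constant_on I \<and> S = f ` I) \<and>
     \<not> (\<exists>a b. a \<noteq> b \<and> closed_segment a b \<subseteq> S)"

end

theory Submission
  imports Defs
    "HOL-Complex_Analysis.Complex_Analysis"
    "HOL-Computational_Algebra.Field_as_Ring"
    "HOL-Computational_Algebra.Polynomial_Factorial"
    "Jordan_Normal_Form.Char_Poly"
begin

text \<open>
  The boundary of a compact convex plane set W is the union of its faces, one for each outer normal
  cis \<theta>. If the support function h of W is differentiable at \<theta>, the face is the single point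
  cis \<theta> * (h \<theta> + \<i> * h' \<theta>) (face_of_differentiable). So if h is real analytic off a finite set
  of angles, then the finitely many exceptional faces are segments, and on each interval between
  exceptional angles this formula is an analytic parametrisation of the remaining boundary. Such a
  piece is a point or a curved arc: it contains no segment, since the face through the midpoint of a
  segment inside W contains the whole segment, whereas the faces met on these intervals are points
  (boundary_of_piecewise_analytic_support).

  It remains to show that the k-numerical range W is compact and convex and that its support function
  is analytic off finitely many angles.

  Convexity. Two k-frames can be rotated inside their spans, without changing the trace of the
  compressed operator, so that the i-th vector of the one is orthogonal to the j-th vector of the
  other for i \<noteq> j; this is a singular value decomposition. The subspaces spanned by pairs of
  corresponding vectors are then mutually orthogonal, and the classical Toeplitz-Hausdorff argument in
  each of them produces frames that realise every point between the two given values
  (convex_numerical_range).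

  Analyticity. By Ky Fan's principle k * h \<theta> is the sum of k eigenvalues of the Hermitian part of
  cis (-\<theta>) * c, taken at orthonormal eigenvectors u 0, ..., u (k-1). The tensor product of
  these eigenvectors is an eigenvector of the Kronecker sum, whose entries, after multiplication by
  z = cis \<theta>, are polynomials in z. Hence cis \<theta> * k * h \<theta> is a root of a monic polynomial
  with coefficients in \<complex>[z] (support_fun_algebraic). A polynomial of least degree with this property
  is squarefree, so by a Bezout identity over \<complex>[z] its roots are simple unless z is one of finitely
  many points (simple_root_polynomial). Along a simple root the continuous function h extends
  holomorphically (algebraic_function_extends). This replaces Rellich's theorem on analytic
  eigenvalues: neither the eigenvalues nor their multiplicities have to be followed individually.
\<close>

section \<open>Orthonormal families in coordinates\<close>

text \<open>
  Vectors are functions on all of \<nat>, and only their first n coordinates are looked at. This form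
  is positive semidefinite and not definite, but no carrier sets are needed and the dimension may vary.
\<close>

definition cip :: "nat \<Rightarrow> (nat \<Rightarrow> complex) \<Rightarrow> (nat \<Rightarrow> complex) \<Rightarrow> complex" where
  "cip n x y = (\<Sum>j<n. x j * cnj (y j))"

definition mv :: "nat \<Rightarrow> (nat \<Rightarrow> nat \<Rightarrow> complex) \<Rightarrow> (nat \<Rightarrow> complex) \<Rightarrow> nat \<Rightarrow> complex" where
  "mv n A x = (\<lambda>i. \<Sum>j<n. A i j * x j)"

definition adj :: "(nat \<Rightarrow> nat \<Rightarrow> complex) \<Rightarrow> nat \<Rightarrow> nat \<Rightarrow> complex" where
  "adj A = (\<lambda>i j. cnj (A j i))"

lemma cip_add_left: "cip n (\<lambda>j. x j + y j) z = cip n x z + cip n y z"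
  by (simp add: cip_def algebra_simps sum.distrib)

lemma cip_diff_left: "cip n (\<lambda>j. x j - y j) z = cip n x z - cip n y z"
  by (simp add: cip_def algebra_simps sum_subtractf)

lemma cip_scale_left: "cip n (\<lambda>j. a * x j) z = a * cip n x z"
  by (simp add: cip_def algebra_simps sum_distrib_left)

lemma cip_sum_left: "cip n (\<lambda>j. \<Sum>i\<in>I. f i j) z = (\<Sum>i\<in>I. cip n (f i) z)"
  unfolding cip_def sum_distrib_right by (rule sum.swap)

lemma cip_commute: "cip n x y = cnj (cip n y x)"
  by (simp add: cip_def algebra_simps)

lemma cip_add_right: "cip n z (\<lambda>j. x j + y j) = cip n z x + cip n z y"
  by (simp add: cip_def algebra_simps sum.distrib)

lemma cip_diff_right: "cip n z (\<lambda>j. x j - y j) = cip n z x - cip n z y"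
  by (simp add: cip_def algebra_simps sum_subtractf)

lemma cip_scale_right: "cip n z (\<lambda>j. a * x j) = cnj a * cip n z x"
  by (simp add: cip_def algebra_simps sum_distrib_left)

lemma cip_sum_right: "cip n z (\<lambda>j. \<Sum>i\<in>I. f i j) = (\<Sum>i\<in>I. cip n z (f i))"
  unfolding cip_def cnj_sum sum_distrib_left by (rule sum.swap)

lemmas cip_linear = cip_add_left cip_diff_left cip_scale_left cip_sum_left
  cip_add_right cip_diff_right cip_scale_right cip_sum_right

lemma cip_self: "cip n x x = of_real (\<Sum>j<n. (cmod (x j))\<^sup>2)"
  by (simp add: cip_def complex_norm_square del: of_real_power)

lemma cip_self_Re: "cip n x x = of_real (Re (cip n x x))"
  by (simp add: cip_self)

lemma cip_self_nonneg: "0 \<le> Re (cip n x x)"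
  by (simp add: cip_self sum_nonneg)

lemma cip_self_eq_0_iff: "cip n x x = 0 \<longleftrightarrow> (\<forall>j<n. x j = 0)"
proof
  assume "cip n x x = 0"
  then have "(\<Sum>j<n. (cmod (x j))\<^sup>2) = 0"
    unfolding cip_self by (simp only: of_real_eq_0_iff)
  then show "\<forall>j<n. x j = 0"
    by (simp add: sum_nonneg_eq_0_iff)
qed (simp add: cip_def)

lemma cip_cong: "(\<And>j. j < n \<Longrightarrow> x j = x' j) \<Longrightarrow> (\<And>j. j < n \<Longrightarrow> y j = y' j) \<Longrightarrow> cip n x y = cip n x' y'"
  by (simp add: cip_def)

lemma cip_unit_left: "b < n \<Longrightarrow> cip n (\<lambda>j. if j = b then 1 else 0) y = cnj (y b)"
  by (simp add: cip_def if_distrib[of "\<lambda>a. a * _"] cong: if_cong)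

lemma mv_linear:
  "mv n A (\<lambda>j. x j + y j) = (\<lambda>i. mv n A x i + mv n A y i)"
  "mv n A (\<lambda>j. x j - y j) = (\<lambda>i. mv n A x i - mv n A y i)"
  "mv n A (\<lambda>j. a * x j) = (\<lambda>i. a * mv n A x i)"
  by (auto simp: mv_def algebra_simps sum.distrib sum_subtractf sum_distrib_left)

lemma mv_sum: "mv n A (\<lambda>j. \<Sum>i\<in>I. f i j) = (\<lambda>j. \<Sum>i\<in>I. mv n A (f i) j)"
  unfolding mv_def sum_distrib_left by (intro ext) (rule sum.swap)

lemma adj_adj [simp]: "adj (adj A) = A"
  by (simp add: adj_def)

lemma cip_mv_left: "cip n (mv n A x) y = cip n x (mv n (adj A) y)"
  unfolding cip_def mv_def adj_def cnj_sum sum_distrib_left sum_distrib_right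
  by (subst sum.swap) (simp add: mult_ac)

lemma orthonormal_ip:
  "orthonormal_family ip k u \<Longrightarrow> i < k \<Longrightarrow> j < k \<Longrightarrow> ip (u i) (u j) = (if i = j then 1 else 0)"
  by (simp add: orthonormal_family_def)

definition residual :: "nat \<Rightarrow> nat \<Rightarrow> (nat \<Rightarrow> nat \<Rightarrow> complex) \<Rightarrow> (nat \<Rightarrow> complex) \<Rightarrow> nat \<Rightarrow> complex" where
  "residual n m u x = (\<lambda>j. x j - (\<Sum>i<m. cip n x (u i) * u i j))"

lemma residual_orthogonal:
  assumes "orthonormal_family (cip n) m u" "i < m"
  shows "cip n (residual n m u x) (u i) = 0"
proof -
  have "(\<Sum>l<m. cip n x (u l) * cip n (u l) (u i)) = (\<Sum>l<m. if l = i then cip n x (u i) else 0)"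
    using assms by (intro sum.cong) (auto simp: orthonormal_ip)
  then show ?thesis
    using assms by (simp add: residual_def cip_linear)
qed

lemma residual_ip_self:
  assumes "orthonormal_family (cip n) m u"
  shows "cip n (residual n m u x) (residual n m u x) = cip n x x - of_real (\<Sum>i<m. (cmod (cip n x (u i)))\<^sup>2)"
proof -
  have "cip n (residual n m u x) (residual n m u x) = cip n (residual n m u x) x"
    by (subst (2) residual_def) (simp add: cip_linear residual_orthogonal[OF assms])
  also have "\<dots> = cip n x x - (\<Sum>i<m. cip n x (u i) * cip n (u i) x)"
    by (simp add: residual_def cip_linear)
  also have "(\<Sum>i<m. cip n x (u i) * cip n (u i) x) = of_real (\<Sum>i<m. (cmod (cip n x (u i)))\<^sup>2)"
    unfolding of_real_sum
  proof (rule sum.cong)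
    fix i
    show "cip n x (u i) * cip n (u i) x = of_real ((cmod (cip n x (u i)))\<^sup>2)"
      by (subst (2) cip_commute) (simp add: complex_norm_square del: of_real_power)
  qed simp
  finally show ?thesis .
qed

lemma bessel:
  assumes "orthonormal_family (cip n) m u"
  shows "(\<Sum>i<m. (cmod (cip n x (u i)))\<^sup>2) \<le> Re (cip n x x)"
  using residual_ip_self[OF assms, of x] cip_self_nonneg[of n "residual n m u x"] by simp

lemma sum_coordinates_orthonormal:
  assumes "orthonormal_family (cip n) m u"
  shows "(\<Sum>b<n. \<Sum>i<m. (cmod (cip n (\<lambda>j. if j = b then 1 else 0) (u i)))\<^sup>2) = real m"
proof -
  have "(\<Sum>b<n. \<Sum>i<m. (cmod (cip n (\<lambda>j. if j = b then 1 else 0) (u i)))\<^sup>2)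
      = (\<Sum>b<n. \<Sum>i<m. (cmod (u i b))\<^sup>2)"
    by (intro sum.cong refl) (simp add: cip_unit_left)
  also have "\<dots> = (\<Sum>i<m. \<Sum>b<n. (cmod (u i b))\<^sup>2)"
    by (rule sum.swap)
  also have "\<dots> = (\<Sum>i<m. 1)"
  proof (rule sum.cong)
    fix i assume "i \<in> {..<m}"
    then have "cip n (u i) (u i) = 1"
      using assms by (simp add: orthonormal_ip)
    then show "(\<Sum>b<n. (cmod (u i b))\<^sup>2) = 1"
      unfolding cip_self using of_real_eq_1_iff by blast
  qed simp
  finally show ?thesis by simp
qed

lemma normalize_vector:
  assumes "cip n x x \<noteq> 0"
  obtains c :: complex where "c \<noteq> 0" "cip n (\<lambda>j. c * x j) (\<lambda>j. c * x j) = 1"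
proof
  define r where "r = Re (cip n x x)"
  have r: "r > 0" "cip n x x = of_real r"
    unfolding r_def using assms cip_self_nonneg[of n x] cip_self_Re[of n x]
    by (metis less_le of_real_0, metis)
  show "complex_of_real (1 / sqrt r) \<noteq> 0" using r by simp
  have "complex_of_real (1 / sqrt r) * (cnj (complex_of_real (1 / sqrt r)) * of_real r)
      = of_real (r / (sqrt r)\<^sup>2)"
    unfolding complex_cnj_complex_of_real of_real_mult[symmetric] by (simp add: power2_eq_square)
  also have "\<dots> = 1" using r by simp
  finally show "cip n (\<lambda>j. complex_of_real (1 / sqrt r) * x j) (\<lambda>j. complex_of_real (1 / sqrt r) * x j) = 1"
    unfolding cip_scale_left cip_scale_right r(2) by (simp only: mult.assoc mult.left_commute)
qed

text \<open>
  The squared norms of the projections of the n unit coordinate vectors onto the span of the family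
  add up to m < n. So one of these vectors has a nonzero residual.
\<close>

lemma exists_orthogonal_unit:
  assumes u: "orthonormal_family (cip n) m u" and "m < n"
  obtains x where "cip n x x = 1" "\<And>i. i < m \<Longrightarrow> cip n x (u i) = 0"
proof -
  let ?e = "\<lambda>b j. if j = b then (1::complex) else 0"
  have "\<exists>b<n. cip n (residual n m u (?e b)) (residual n m u (?e b)) \<noteq> 0"
  proof (rule ccontr)
    assume "\<not> ?thesis"
    then have "\<forall>b<n. cip n (?e b) (?e b) = of_real (\<Sum>i<m. (cmod (cip n (?e b) (u i)))\<^sup>2)"
      using residual_ip_self[OF u] by simp
    moreover have "\<forall>b<n. cip n (?e b) (?e b) = of_real 1"
      by (simp add: cip_unit_left)
    ultimately have "\<forall>b<n. (\<Sum>i<m. (cmod (cip n (?e b) (u i)))\<^sup>2) = 1"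
      using of_real_eq_iff by metis
    then have "(\<Sum>b<n. \<Sum>i<m. (cmod (cip n (?e b) (u i)))\<^sup>2) = (\<Sum>b<n. 1)"
      by (intro sum.cong) blast+
    then show False
      using sum_coordinates_orthonormal[OF u] \<open>m < n\<close> by simp
  qed
  then obtain b where b: "cip n (residual n m u (?e b)) (residual n m u (?e b)) \<noteq> 0" by blast
  obtain c where c: "cip n (\<lambda>j. c * residual n m u (?e b) j) (\<lambda>j. c * residual n m u (?e b) j) = 1"
    using normalize_vector[OF b] by blast
  show thesis
    by (rule that[OF c]) (simp add: cip_linear residual_orthogonal[OF u])
qed

lemma orthonormal_extend1:
  assumes u: "orthonormal_family (cip n) m u"
    and x: "cip n x x = 1" "\<And>i. i < m \<Longrightarrow> cip n x (u i) = 0"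
  shows "orthonormal_family (cip n) (Suc m) (u(m := x))"
proof -
  have "cip n (u i) x = 0" if "i < m" for i
    using x(2)[OF that] cip_commute[of n "u i" x] by simp
  then show ?thesis
    using x u by (auto simp: orthonormal_family_def less_Suc_eq)
qed

text \<open>
  Bessel's inequality, summed over the n unit coordinate vectors.
\<close>

lemma orthonormal_le_dim:
  assumes u: "orthonormal_family (cip n) m u"
  shows "m \<le> n"
proof -
  let ?e = "\<lambda>b j. if j = b then (1::complex) else 0"
  have "real m = (\<Sum>b<n. \<Sum>i<m. (cmod (cip n (?e b) (u i)))\<^sup>2)"
    using sum_coordinates_orthonormal[OF u] by simp
  also have "\<dots> \<le> (\<Sum>b<n. Re (cip n (?e b) (?e b)))"
    by (intro sum_mono bessel[OF u])
  also have "\<dots> = real n" by (simp add: cip_unit_left)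
  finally show ?thesis by simp
qed

text \<open>
  A nonzero residual could be normalised and added to the family, giving n + 1 orthonormal vectors.
\<close>

lemma orthonormal_basis_expansion:
  assumes u: "orthonormal_family (cip n) n u" and "j < n"
  shows "x j = (\<Sum>i<n. cip n x (u i) * u i j)"
proof -
  let ?r = "residual n n u x"
  have "cip n ?r ?r = 0"
  proof (rule ccontr)
    assume "cip n ?r ?r \<noteq> 0"
    from normalize_vector[OF this] obtain c where c: "cip n (\<lambda>j. c * ?r j) (\<lambda>j. c * ?r j) = 1" by blast
    have "orthonormal_family (cip n) (Suc n) (u(n := (\<lambda>j. c * ?r j)))"
      by (rule orthonormal_extend1[OF u c]) (simp add: cip_linear residual_orthogonal[OF u])
    from orthonormal_le_dim[OF this] show False by simp
  qed
  then have "?r j = 0" using \<open>j < n\<close> cip_self_eq_0_iff by blast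
  then show ?thesis by (simp add: residual_def)
qed

text \<open>
  For a square matrix, orthonormality of the rows gives orthonormality of the columns: expand the
  unit coordinate vectors in the basis.
\<close>

lemma unitary_columns:
  assumes u: "orthonormal_family (cip n) n u" and "a < n" "b < n"
  shows "(\<Sum>i<n. u i a * cnj (u i b)) = (if a = b then 1 else 0)"
  using orthonormal_basis_expansion[OF u \<open>a < n\<close>, of "\<lambda>j. if j = b then 1 else 0"]
  by (simp add: cip_unit_left[OF \<open>b < n\<close>] mult.commute)

lemma orthonormal_extend:
  assumes u: "orthonormal_family (cip n) m u" and "m \<le> n"
  obtains v where "orthonormal_family (cip n) n v" "\<And>i. i < m \<Longrightarrow> v i = u i"
proof -
  have "\<exists>v. orthonormal_family (cip n) (m + d) v \<and> (\<forall>i<m. v i = u i)" if "m + d \<le> n" for d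
    using that
  proof (induction d)
    case 0
    then show ?case using u by auto
  next
    case (Suc d)
    then obtain v where v: "orthonormal_family (cip n) (m + d) v" "\<forall>i<m. v i = u i" by auto
    obtain x where x: "cip n x x = 1" "\<And>i. i < m + d \<Longrightarrow> cip n x (v i) = 0"
      using exists_orthogonal_unit[OF v(1)] Suc.prems by auto
    have "orthonormal_family (cip n) (Suc (m + d)) (v(m + d := x))"
      by (rule orthonormal_extend1[OF v(1) x])
    moreover have "\<forall>i<m. (v(m + d := x)) i = u i" using v(2) by simp
    ultimately show ?case by (metis add_Suc_right)
  qed
  from this[of "n - m"] \<open>m \<le> n\<close> that show thesis by auto
qed

section \<open>Compactness of frames and of the numerical range\<close>

text \<open>
  Tychonoff's theorem for the product topology on sequences.
\<close>

lemma compact_product: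
  fixes K :: "nat \<Rightarrow> 'b::topological_space set"
  assumes "\<And>i. compact (K i)"
  shows "compact {x. \<forall>i. x i \<in> K i}"
proof -
  have "compactin (product_topology (\<lambda>i. euclidean) UNIV) (PiE UNIV K)"
    using assms by (subst compactin_PiE) auto
  moreover have "PiE UNIV K = {x. \<forall>i. x i \<in> K i}" by (auto simp: PiE_def)
  ultimately show ?thesis
    using euclidean_product_topology compactin_euclidean_iff by metis
qed

lemma continuous_on_cip [continuous_intros]:
  fixes f g :: "'b::topological_space \<Rightarrow> nat \<Rightarrow> complex"
  assumes "\<And>j. continuous_on S (\<lambda>t. f t j)" "\<And>j. continuous_on S (\<lambda>t. g t j)"
  shows "continuous_on S (\<lambda>t. cip n (f t) (g t))"
  unfolding cip_def using assms by (intro continuous_intros)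

lemma continuous_on_mv [continuous_intros]:
  fixes f :: "'b::topological_space \<Rightarrow> nat \<Rightarrow> complex"
  assumes "\<And>j. continuous_on S (\<lambda>t. f t j)"
  shows "continuous_on S (\<lambda>t. mv n A (f t) i)"
  unfolding mv_def using assms by (intro continuous_intros)

lemma continuous_on_coord: "continuous_on S (\<lambda>x::nat \<Rightarrow> 'b::topological_space. x j)"
  by (rule continuous_on_subset[OF continuous_on_product_coordinates]) simp

lemma continuous_on_coord2: "continuous_on S (\<lambda>X::nat \<Rightarrow> nat \<Rightarrow> 'b::topological_space. X i j)"
  by (rule continuous_on_product_then_coordinatewise[OF continuous_on_coord])

lemma unit_vector_coord_le:
  assumes "cip n x x = 1" "j < n"
  shows "cmod (x j) \<le> 1"
proof -
  have "(\<Sum>j<n. (cmod (x j))\<^sup>2) = 1"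
    using assms(1) unfolding cip_self using of_real_eq_1_iff by blast
  then have "(cmod (x j))\<^sup>2 \<le> 1"
    using member_le_sum[of j "{..<n}" "\<lambda>j. (cmod (x j))\<^sup>2"] assms(2) by auto
  then show ?thesis by (simp add: power_le_one_iff abs_square_le_1)
qed

text \<open>
  Zeroing the coordinates beyond n does not affect the inner product, but it moves vectors and
  frames into a compact set.
\<close>

definition trunc :: "nat \<Rightarrow> (nat \<Rightarrow> complex) \<Rightarrow> nat \<Rightarrow> complex" where
  "trunc n x = (\<lambda>j. if j < n then x j else 0)"

lemma cip_trunc [simp]: "cip n (trunc n x) y = cip n x y" "cip n x (trunc n y) = cip n x y"
  by (simp_all add: cip_def trunc_def)

lemma mv_trunc [simp]: "mv n A (trunc n x) = mv n A x"
  by (simp add: mv_def trunc_def)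

lemma compact_unit_vectors:
  "compact {x. (\<forall>j\<ge>n. x j = 0) \<and> cip n x x = 1 \<and> (\<forall>i<m. cip n x (u i) = 0)}" (is "compact ?S")
proof -
  let ?K = "\<lambda>j. if j < n then cball (0::complex) 1 else {0}"
  have "compact {x. \<forall>j. x j \<in> ?K j}" by (rule compact_product) auto
  moreover have "closed {x. cip n x x = 1 \<and> (\<forall>i<m. cip n x (u i) = 0)}"
    unfolding Collect_conj_eq Collect_all_eq Collect_imp_eq
    by (intro closed_Int closed_INT ballI closed_Un closed_Collect_eq
        continuous_on_cip continuous_on_coord continuous_on_const) (auto simp: Collect_const)
  ultimately have "compact ({x. \<forall>j. x j \<in> ?K j} \<inter> {x. cip n x x = 1 \<and> (\<forall>i<m. cip n x (u i) = 0)})"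
    by (rule compact_Int_closed)
  moreover have "?S = {x. \<forall>j. x j \<in> ?K j} \<inter> {x. cip n x x = 1 \<and> (\<forall>i<m. cip n x (u i) = 0)}"
    by (auto simp: unit_vector_coord_le split: if_splits)
  ultimately show ?thesis by simp
qed

lemma compact_frames:
  "compact {X. (\<forall>i j. (i \<ge> k \<or> j \<ge> n) \<longrightarrow> X i j = 0) \<and> orthonormal_family (cip n) k X}" (is "compact ?S")
proof -
  let ?L = "\<lambda>i j. if i < k \<and> j < n then cball (0::complex) 1 else {0}"
  have 1: "compact {X. \<forall>i. X i \<in> {x. \<forall>j. x j \<in> ?L i j}}"
    by (intro compact_product) auto
  have 2: "closed {X. orthonormal_family (cip n) k X}"
    unfolding orthonormal_family_def Collect_conj_eq Collect_all_eq Collect_imp_eq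
    by (intro closed_Int closed_INT ballI closed_Un closed_Collect_eq
        continuous_on_cip continuous_on_coord2 continuous_on_const) (auto simp: Collect_const)
  have "compact ({X. \<forall>i. X i \<in> {x. \<forall>j. x j \<in> ?L i j}} \<inter> {X. orthonormal_family (cip n) k X})"
    by (rule compact_Int_closed[OF 1 2])
  moreover have "cmod (X i j) \<le> 1" if "orthonormal_family (cip n) k X" "i < k" "j < n" for X i j
    by (rule unit_vector_coord_le[OF _ that(3)]) (use that in \<open>simp add: orthonormal_family_def\<close>)
  then have "?S = {X. \<forall>i. X i \<in> {x. \<forall>j. x j \<in> ?L i j}} \<inter> {X. orthonormal_family (cip n) k X}"
    by (auto split: if_splits)
  ultimately show ?thesis by metis
qed

lemma compact_numerical_range: "compact (numerical_range (cip n) k (mv n A))"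
proof -
  let ?S = "{X. (\<forall>i j. (i \<ge> k \<or> j \<ge> n) \<longrightarrow> X i j = 0) \<and> orthonormal_family (cip n) k X}"
  let ?f = "\<lambda>X. (1 / of_nat k) * (\<Sum>i<k. cip n (mv n A (X i)) (X i))"
  have "numerical_range (cip n) k (mv n A) = ?f ` ?S"
  proof (intro equalityI subsetI)
    fix w assume "w \<in> numerical_range (cip n) k (mv n A)"
    then obtain x where x: "orthonormal_family (cip n) k x" "w = ?f x"
      unfolding numerical_range_def by blast
    define X where "X = (\<lambda>i. if i < k then trunc n (x i) else (\<lambda>j. 0))"
    have "X \<in> ?S" using x(1) by (simp add: X_def orthonormal_family_def) (simp add: trunc_def)
    moreover have "?f X = w" using x(2) by (simp add: X_def)
    ultimately show "w \<in> ?f ` ?S" by blast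
  next
    fix w assume "w \<in> ?f ` ?S"
    then show "w \<in> numerical_range (cip n) k (mv n A)"
      unfolding numerical_range_def by blast
  qed
  moreover have "continuous_on ?S ?f"
    by (intro continuous_on_mult continuous_on_const continuous_on_sum continuous_on_cip
        continuous_on_mv continuous_on_coord2)
  then have "compact (?f ` ?S)"
    by (rule compact_continuous_image[OF _ compact_frames])
  ultimately show ?thesis by simp
qed

section \<open>Leading eigenvectors and Ky Fan's maximum principle\<close>

text \<open>
  At t = c / (\<bar>d\<bar> + 1) the linear term dominates the quadratic one.
\<close>

lemma quadratic_nonpos_imp_linear_zero:
  fixes c d :: real
  assumes "\<And>t. 2 * t * c + t\<^sup>2 * d \<le> 0"
  shows "c = 0"
proof (rule ccontr)
  assume "c \<noteq> 0"
  define e where "e = \<bar>d\<bar> + 1"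
  have e: "e > 0" "d \<ge> - e" by (auto simp: e_def)
  have "2 * (c / e) * c + (c / e)\<^sup>2 * d \<ge> 2 * (c / e) * c - (c / e)\<^sup>2 * e"
    using mult_left_mono[OF e(2), of "(c / e)\<^sup>2"] by simp
  also have "2 * (c / e) * c - (c / e)\<^sup>2 * e = c\<^sup>2 / e"
    using e(1) by (simp add: power2_eq_square field_simps)
  finally show False
    using assms[of "c / e"] e(1) \<open>c \<noteq> 0\<close> by (smt (verit) divide_pos_pos zero_less_power2)
qed

lemma cip_eigenvector_left:
  assumes "\<And>j. j < n \<Longrightarrow> mv n H v j = a * v j"
  shows "cip n (mv n H v) y = a * cip n v y"
  using cip_cong[of n "mv n H v" "\<lambda>j. a * v j" y y] assms by (simp add: cip_scale_left)

lemma cip_eigenvector_right: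
  assumes "\<And>j. j < n \<Longrightarrow> mv n H v j = a * v j"
  shows "cip n y (mv n H v) = cnj a * cip n y v"
  using cip_cong[of n y y "mv n H v" "\<lambda>j. a * v j"] assms by (simp add: cip_scale_right)

text \<open>
  First variation: z is, up to a factor, the gradient of the Rayleigh quotient at x. It is orthogonal to the earlier
  eigenvectors, so x may be perturbed in the direction z, and maximality forces the derivative,
  which is twice the squared norm of z, to vanish.
\<close>

lemma maximiser_is_eigenvector:
  assumes H: "adj H = H"
    and u: "\<And>i j. i < m \<Longrightarrow> j < n \<Longrightarrow> mv n H (u i) j = complex_of_real (lam i) * u i j"
    and x: "cip n x x = 1" "\<And>i. i < m \<Longrightarrow> cip n x (u i) = 0"
    and max: "\<And>y. (\<And>i. i < m \<Longrightarrow> cip n y (u i) = 0) \<Longrightarrow>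
        Re (cip n (mv n H y) y) \<le> \<mu> * Re (cip n y y)"
    and \<mu>: "\<mu> = Re (cip n (mv n H x) x)"
    and "j < n"
  shows "mv n H x j = of_real \<mu> * x j"
proof -
  define z where "z = (\<lambda>j. mv n H x j - of_real \<mu> * x j)"
  have zu: "cip n z (u i) = 0" if "i < m" for i
    using that x(2) u by (simp add: z_def cip_linear cip_mv_left H cip_eigenvector_right[where a = "of_real (lam i)"])
  define c where "c = Re (cip n z z)"
  define d where "d = Re (cip n (mv n H z) z) - \<mu> * Re (cip n z z)"
  have "2 * t * c + t\<^sup>2 * d \<le> 0" for t
  proof -
    let ?y = "\<lambda>j. x j + of_real t * z j"
    have "Re (cip n (mv n H ?y) ?y) \<le> \<mu> * Re (cip n ?y ?y)"
      by (rule max) (simp add: cip_linear x(2) zu)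
    moreover have "Re (cip n (mv n H ?y) ?y) =
        \<mu> + 2 * t * Re (cip n (mv n H x) z) + t\<^sup>2 * Re (cip n (mv n H z) z)"
    proof -
      have "cip n (mv n H z) x = cnj (cip n (mv n H x) z)"
        using cip_mv_left[of n H z x] cip_commute[of n z "mv n H x"] by (simp add: H)
      then show ?thesis
        by (simp add: mv_linear cip_linear \<mu> algebra_simps power2_eq_square)
    qed
    moreover have "Re (cip n ?y ?y) = 1 + 2 * t * Re (cip n x z) + t\<^sup>2 * Re (cip n z z)"
    proof -
      have "cip n z x = cnj (cip n x z)" by (rule cip_commute)
      then show ?thesis
        by (simp add: cip_linear x(1) algebra_simps power2_eq_square)
    qed
    moreover have "c = Re (cip n (mv n H x) z) - \<mu> * Re (cip n x z)"
      unfolding c_def by (subst z_def) (simp add: cip_diff_left cip_scale_left)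
    ultimately have "\<mu> + 2 * t * Re (cip n (mv n H x) z) + t\<^sup>2 * Re (cip n (mv n H z) z)
        \<le> \<mu> * (1 + 2 * t * Re (cip n x z) + t\<^sup>2 * Re (cip n z z))"
      and c: "Re (cip n (mv n H x) z) = c + \<mu> * Re (cip n x z)"
      by simp_all
    then show ?thesis
      unfolding c d_def by (simp add: algebra_simps)
  qed
  then have "c = 0" by (rule quadratic_nonpos_imp_linear_zero)
  then have "cip n z z = 0" unfolding c_def by (subst cip_self_Re) simp
  then show ?thesis using \<open>j < n\<close> by (simp add: cip_self_eq_0_iff z_def)
qed

lemma rayleigh_maximum:
  assumes u: "orthonormal_family (cip n) m u" and "m < n"
  obtains x where "cip n x x = 1" "\<And>i. i < m \<Longrightarrow> cip n x (u i) = 0"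
    "\<And>y. (\<And>i. i < m \<Longrightarrow> cip n y (u i) = 0) \<Longrightarrow>
        Re (cip n (mv n H y) y) \<le> Re (cip n (mv n H x) x) * Re (cip n y y)"
proof -
  let ?S = "{x. (\<forall>j\<ge>n. x j = 0) \<and> cip n x x = 1 \<and> (\<forall>i<m. cip n x (u i) = 0)}"
  let ?q = "\<lambda>x. Re (cip n (mv n H x) x)"
  obtain x0 where "cip n x0 x0 = 1" "\<And>i. i < m \<Longrightarrow> cip n x0 (u i) = 0"
    using exists_orthogonal_unit[OF assms] by blast
  then have "trunc n x0 \<in> ?S" by (simp) (simp add: trunc_def)
  then have "?S \<noteq> {}" by blast
  moreover have "continuous_on ?S ?q"
    by (intro continuous_on_Re continuous_on_cip continuous_on_mv continuous_on_coord)
  ultimately obtain x where x: "x \<in> ?S" and max: "\<And>y. y \<in> ?S \<Longrightarrow> ?q y \<le> ?q x"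
    using continuous_attains_sup[OF compact_unit_vectors, of n m u ?q] by blast
  show thesis
  proof (rule that[of x])
    fix y assume y: "\<And>i. i < m \<Longrightarrow> cip n y (u i) = 0"
    show "?q y \<le> ?q x * Re (cip n y y)"
    proof (cases "cip n y y = 0")
      case True
      then have "\<forall>j<n. y j = 0" by (simp add: cip_self_eq_0_iff)
      then have "cip n (mv n H y) y = 0" by (simp add: cip_def)
      then show ?thesis using True by simp
    next
      case False
      from normalize_vector[OF False] obtain c
        where c: "c \<noteq> 0" "cip n (\<lambda>j. c * y j) (\<lambda>j. c * y j) = 1" by blast
      let ?z = "trunc n (\<lambda>j. c * y j)"
      have "?z \<in> ?S" using c(2) y by (simp add: cip_scale_left) (simp add: trunc_def)
      from max[OF this] have "Re (c * cnj c * cip n (mv n H y) y) \<le> ?q x"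
        by (simp add: mv_linear cip_scale_left cip_scale_right mult.assoc)
      then have q: "(cmod c)\<^sup>2 * ?q y \<le> ?q x"
        unfolding complex_norm_square[symmetric] Re_complex_of_real[symmetric]
        by (simp del: of_real_power)
      have "c * cnj c * cip n y y = 1"
        using c(2) by (simp add: cip_scale_left cip_scale_right mult.assoc)
      then have "of_real ((cmod c)\<^sup>2 * Re (cip n y y)) = (1::complex)"
        by (simp only: of_real_mult complex_norm_square cip_self_Re[symmetric])
      then have N: "(cmod c)\<^sup>2 * Re (cip n y y) = 1"
        using of_real_eq_1_iff by blast
      have "?q y = (cmod c)\<^sup>2 * ?q y * Re (cip n y y)"
        using N by (simp add: mult.commute mult.left_commute)
      also have "\<dots> \<le> ?q x * Re (cip n y y)"
        using q cip_self_nonneg by (rule mult_right_mono)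
      finally show ?thesis .
    qed
  qed (use x in auto)
qed

text \<open>
  Greedy construction: maximise the Rayleigh quotient on the orthogonal complement of the vectors
  already found. For m = n this is the spectral theorem with the eigenvalues in decreasing order;
  for m < n the third clause keeps the information that Ky Fan's principle needs about the
  complement.
\<close>

lemma leading_eigenvectors:
  assumes H: "adj H = H" and "m \<le> n"
  shows "\<exists>u lam. orthonormal_family (cip n) m u
    \<and> (\<forall>i<m. \<forall>j<n. mv n H (u i) j = complex_of_real (lam i) * u i j)
    \<and> (\<forall>i<m. \<forall>y. (\<forall>l<m. cip n y (u l) = 0) \<longrightarrow> Re (cip n (mv n H y) y) \<le> lam i * Re (cip n y y))
    \<and> (\<forall>i j. i \<le> j \<longrightarrow> j < m \<longrightarrow> lam j \<le> lam i)"
  using \<open>m \<le> n\<close>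
proof (induction m)
  case 0
  then show ?case by (simp add: orthonormal_family_def)
next
  case (Suc m)
  then obtain u lam where u: "orthonormal_family (cip n) m u"
    and ev: "\<forall>i<m. \<forall>j<n. mv n H (u i) j = complex_of_real (lam i) * u i j"
    and bd: "\<forall>i<m. \<forall>y. (\<forall>l<m. cip n y (u l) = 0) \<longrightarrow> Re (cip n (mv n H y) y) \<le> lam i * Re (cip n y y)"
    and dec: "\<forall>i j. i \<le> j \<longrightarrow> j < m \<longrightarrow> lam j \<le> lam i"
    using Suc_leD by blast
  obtain x where x: "cip n x x = 1" "\<And>i. i < m \<Longrightarrow> cip n x (u i) = 0"
    and max: "\<And>y. (\<And>i. i < m \<Longrightarrow> cip n y (u i) = 0) \<Longrightarrow>
        Re (cip n (mv n H y) y) \<le> Re (cip n (mv n H x) x) * Re (cip n y y)"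
    using rayleigh_maximum[OF u, of H] Suc.prems by auto
  define \<mu> where "\<mu> = Re (cip n (mv n H x) x)"
  have evx: "mv n H x j = of_real \<mu> * x j" if "j < n" for j
    by (rule maximiser_is_eigenvector[where lam = lam, OF H _ x max[folded \<mu>_def] \<mu>_def that])
      (simp_all add: ev)
  have le: "\<mu> \<le> lam i" if "i < m" for i
    using bd[rule_format, OF that, of x] x by (simp add: \<mu>_def)
  have "orthonormal_family (cip n) (Suc m) (u(m := x))"
    by (rule orthonormal_extend1[OF u x])
  moreover have "\<forall>i<Suc m. \<forall>j<n. mv n H ((u(m := x)) i) j = complex_of_real ((lam(m := \<mu>)) i) * (u(m := x)) i j"
    using ev evx by (auto simp: less_Suc_eq)
  moreover have "\<forall>i<Suc m. \<forall>y. (\<forall>l<Suc m. cip n y ((u(m := x)) l) = 0) \<longrightarrow>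
      Re (cip n (mv n H y) y) \<le> (lam(m := \<mu>)) i * Re (cip n y y)"
  proof (intro allI impI)
    fix i y assume "i < Suc m" and "\<forall>l<Suc m. cip n y ((u(m := x)) l) = 0"
    then have y: "\<forall>l<m. cip n y (u l) = 0"
      by (auto simp: less_Suc_eq)
    show "Re (cip n (mv n H y) y) \<le> (lam(m := \<mu>)) i * Re (cip n y y)"
    proof (cases "i = m")
      case True
      then show ?thesis using max[of y] y by (simp add: \<mu>_def)
    next
      case False
      then have "i < m" using \<open>i < Suc m\<close> by simp
      then show ?thesis using bd[rule_format, of i y] y by simp
    qed
  qed
  moreover have "\<forall>i j. i \<le> j \<longrightarrow> j < Suc m \<longrightarrow> (lam(m := \<mu>)) j \<le> (lam(m := \<mu>)) i"
    using dec le by (auto simp: less_Suc_eq)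
  ultimately show ?case by (intro exI conjI)
qed

text \<open>
  On a vector y the form is at most \<mu> * |y|^2 plus the excess of the eigenvalues over \<mu> on the
  components of y along the u i. Summing over an orthonormal family x, Bessel's inequality bounds
  the total weight of each component by 1.
\<close>

lemma ky_fan_bound:
  assumes H: "adj H = H" and u: "orthonormal_family (cip n) k u"
    and ev: "\<And>i j. i < k \<Longrightarrow> j < n \<Longrightarrow> mv n H (u i) j = complex_of_real (lam i) * u i j"
    and bd: "\<And>y. (\<And>l. l < k \<Longrightarrow> cip n y (u l) = 0) \<Longrightarrow> Re (cip n (mv n H y) y) \<le> \<mu> * Re (cip n y y)"
    and \<mu>: "\<And>i. i < k \<Longrightarrow> \<mu> \<le> lam i"
    and x: "orthonormal_family (cip n) k x"
  shows "(\<Sum>i<k. Re (cip n (mv n H (x i)) (x i))) \<le> (\<Sum>i<k. lam i)"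
proof -
  have one: "Re (cip n (mv n H y) y) \<le> \<mu> * Re (cip n y y) + (\<Sum>i<k. (lam i - \<mu>) * (cmod (cip n y (u i)))\<^sup>2)" for y
  proof -
    define a where "a = (\<lambda>i. cip n y (u i))"
    define r where "r = residual n k u y"
    define s where "s = (\<lambda>j. \<Sum>i<k. a i * u i j)"
    have y: "y = (\<lambda>j. r j + s j)" by (auto simp: r_def residual_def s_def a_def)
    have ru: "cip n r (u i) = 0" if "i < k" for i
      unfolding r_def by (rule residual_orthogonal[OF u that])
    have Hs: "cip n (mv n H s) v = (\<Sum>i<k. a i * (lam i * cip n (u i) v))" for v
      unfolding s_def mv_sum mv_linear cip_sum_left cip_scale_left
      by (intro sum.cong refl) (metis cip_eigenvector_left ev lessThan_iff)
    have "cip n (mv n H r) s = cip n r (mv n H s)" by (simp add: cip_mv_left H)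
    also have "\<dots> = cnj (cip n (mv n H s) r)" by (rule cip_commute)
    also have "\<dots> = 0"
    proof -
      have "cip n (u i) r = 0" if "i < k" for i
        using ru[OF that] cip_commute[of n "u i" r] by simp
      then show ?thesis by (simp add: Hs)
    qed
    finally have "cip n (mv n H r) s = 0" .
    then have "cip n (mv n H r) y = cip n (mv n H r) r"
      by (subst y) (simp add: cip_add_right)
    moreover have "cip n (mv n H s) y = of_real (\<Sum>i<k. lam i * (cmod (a i))\<^sup>2)"
    proof -
      have "a i * (lam i * cip n (u i) y) = of_real (lam i * (cmod (a i))\<^sup>2)" for i
      proof -
        have "cip n (u i) y = cnj (a i)" unfolding a_def by (rule cip_commute)
        then show ?thesis by (simp add: complex_norm_square[symmetric] mult.left_commute del: of_real_power)
      qed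
      then show ?thesis by (simp add: Hs del: of_real_mult)
    qed
    moreover have "cip n (mv n H y) y = cip n (mv n H r) y + cip n (mv n H s) y"
      by (subst (1) y) (simp only: mv_linear cip_add_left)
    ultimately have "Re (cip n (mv n H y) y) = Re (cip n (mv n H r) r) + (\<Sum>i<k. lam i * (cmod (a i))\<^sup>2)"
      by simp
    moreover have "Re (cip n (mv n H r) r) \<le> \<mu> * Re (cip n r r)"
      by (rule bd) (rule ru)
    moreover have "Re (cip n r r) = Re (cip n y y) - (\<Sum>i<k. (cmod (a i))\<^sup>2)"
      unfolding r_def a_def residual_ip_self[OF u] by simp
    ultimately show ?thesis
      by (simp add: a_def algebra_simps sum_subtractf sum_distrib_left)
  qed
  have "(\<Sum>i<k. Re (cip n (mv n H (x i)) (x i)))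
     \<le> (\<Sum>i<k. \<mu> * Re (cip n (x i) (x i)) + (\<Sum>l<k. (lam l - \<mu>) * (cmod (cip n (x i) (u l)))\<^sup>2))"
    by (intro sum_mono one)
  also have "\<dots> = real k * \<mu> + (\<Sum>l<k. (lam l - \<mu>) * (\<Sum>i<k. (cmod (cip n (x i) (u l)))\<^sup>2))"
    unfolding sum.distrib
    by (subst sum.swap) (use x in \<open>simp add: orthonormal_family_def sum_distrib_left\<close>)
  also have "\<dots> \<le> real k * \<mu> + (\<Sum>l<k. (lam l - \<mu>) * 1)"
  proof (intro add_left_mono sum_mono mult_left_mono)
    fix l assume l: "l \<in> {..<k}"
    have "(\<Sum>i<k. (cmod (cip n (x i) (u l)))\<^sup>2) = (\<Sum>i<k. (cmod (cip n (u l) (x i)))\<^sup>2)"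
      by (intro sum.cong refl) (simp add: cip_commute[of n "u l"])
    also have "\<dots> \<le> Re (cip n (u l) (u l))" by (rule bessel[OF x])
    also have "\<dots> = 1" using u l by (simp add: orthonormal_family_def)
    finally show "(\<Sum>i<k. (cmod (cip n (x i) (u l)))\<^sup>2) \<le> 1" .
    show "0 \<le> lam l - \<mu>" using \<mu> l by simp
  qed
  also have "\<dots> = (\<Sum>i<k. lam i)" by (simp add: sum_subtractf)
  finally show ?thesis .
qed

lemma ky_fan:
  assumes H: "adj H = H" and "0 < k" "k \<le> n"
  obtains u lam where "orthonormal_family (cip n) k u"
    "\<forall>i<k. \<forall>j<n. mv n H (u i) j = complex_of_real (lam i) * u i j"
    "\<forall>x. orthonormal_family (cip n) k x \<longrightarrow>
       (\<Sum>i<k. Re (cip n (mv n H (x i)) (x i))) \<le> (\<Sum>i<k. lam i)"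
proof -
  obtain u lam where u: "orthonormal_family (cip n) k u"
    and ev: "\<forall>i<k. \<forall>j<n. mv n H (u i) j = complex_of_real (lam i) * u i j"
    and bd: "\<forall>i<k. \<forall>y. (\<forall>l<k. cip n y (u l) = 0) \<longrightarrow> Re (cip n (mv n H y) y) \<le> lam i * Re (cip n y y)"
    and dec: "\<forall>i j. i \<le> j \<longrightarrow> j < k \<longrightarrow> lam j \<le> lam i"
    using leading_eigenvectors[OF H \<open>k \<le> n\<close>] by (elim exE conjE) (rule that, assumption+)
  show thesis
  proof (rule that[OF u ev], intro allI impI)
    fix x assume x: "orthonormal_family (cip n) k x"
    show "(\<Sum>i<k. Re (cip n (mv n H (x i)) (x i))) \<le> (\<Sum>i<k. lam i)"
    proof (rule ky_fan_bound[OF H u _ _ _ x, where \<mu> = "lam (k - 1)"])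
      show "\<And>y. (\<And>l. l < k \<Longrightarrow> cip n y (u l) = 0) \<Longrightarrow> Re (cip n (mv n H y) y) \<le> lam (k - 1) * Re (cip n y y)"
        using bd \<open>0 < k\<close> by simp
    qed (use ev dec \<open>0 < k\<close> in auto)
  qed
qed

section \<open>Convexity of the numerical range\<close>

text \<open>
  The columns of V are eigenvectors of the positive matrix G^* G, hence the images G (V i) are mutually
  orthogonal. Normalise the nonzero ones, which come first because the eigenvalues decrease, and
  complete them to an orthonormal basis.
\<close>

lemma singular_value_decomposition:
  fixes G :: "nat \<Rightarrow> nat \<Rightarrow> complex"
  obtains U V where "orthonormal_family (cip k) k U" "orthonormal_family (cip k) k V"
    "\<And>i j. i < k \<Longrightarrow> j < k \<Longrightarrow> i \<noteq> j \<Longrightarrow> cip k (mv k G (V i)) (U j) = 0"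
proof -
  define H where "H = (\<lambda>i j. \<Sum>l<k. cnj (G l i) * G l j)"
  have H: "adj H = H" by (simp add: adj_def H_def mult.commute)
  have mvH: "mv k H x = mv k (adj G) (mv k G x)" for x
    unfolding mv_def H_def adj_def sum_distrib_left sum_distrib_right
    by (intro ext, subst sum.swap) (simp add: mult.assoc)
  obtain V lam where V: "orthonormal_family (cip k) k V"
    and ev: "\<forall>i<k. \<forall>j<k. mv k H (V i) j = complex_of_real (lam i) * V i j"
    and "\<forall>i<k. \<forall>y. (\<forall>l<k. cip k y (V l) = 0) \<longrightarrow> Re (cip k (mv k H y) y) \<le> lam i * Re (cip k y y)"
    and dec: "\<forall>i j. i \<le> j \<longrightarrow> j < k \<longrightarrow> lam j \<le> lam i"
    using leading_eigenvectors[OF H order_refl[of k]] by (elim exE conjE) (rule that, assumption+)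
  define w where "w = (\<lambda>i. mv k G (V i))"
  have ww: "cip k (w i) (w j) = (if i = j then of_real (lam i) else 0)" if "i < k" "j < k" for i j
  proof -
    have "cip k (w i) (w j) = cip k (V i) (mv k H (V j))"
      unfolding w_def cip_mv_left mvH ..
    also have "\<dots> = of_real (lam j) * cip k (V i) (V j)"
      using cip_eigenvector_right[of k H "V j" "of_real (lam j)" "V i"] ev that by simp
    finally show ?thesis using that V by (simp add: orthonormal_family_def)
  qed
  have lam0: "0 \<le> lam i" if "i < k" for i
    using ww[OF that that] cip_self_nonneg[of k "w i"] by simp
  \<comment> \<open>the number of nonzero singular values\<close>
  define r where "r = (LEAST r. r = k \<or> lam r = 0)"
  have r1: "r = k \<or> lam r = 0" unfolding r_def by (rule LeastI[of _ k]) simp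
  have r2: "r \<le> k" unfolding r_def by (rule Least_le) simp
  have r_less: "lam i \<noteq> 0" if "i < r" for i
    using not_less_Least[OF that[unfolded r_def]] by simp
  note r = r1 r2
  define U0 where "U0 = (\<lambda>i j. of_real (1 / sqrt (lam i)) * w i j)"
  have "orthonormal_family (cip k) r U0"
    unfolding orthonormal_family_def
  proof (intro allI impI)
    fix i j assume ij: "i < r" "j < r"
    then have "lam i > 0" using lam0[of i] r(2) r_less[of i] by simp
    then have "complex_of_real (1 / sqrt (lam i)) * (complex_of_real (1 / sqrt (lam i)) * of_real (lam i)) = 1"
      unfolding of_real_mult[symmetric] by simp
    then show "cip k (U0 i) (U0 j) = (if i = j then 1 else 0)"
      unfolding U0_def cip_scale_left cip_scale_right complex_cnj_complex_of_real
      using ww[of i j] ij r2 by (cases "i = j") (simp_all del: of_real_divide)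
  qed
  from orthonormal_extend[OF this r(2)] obtain U
    where U: "orthonormal_family (cip k) k U" "\<And>i. i < r \<Longrightarrow> U i = U0 i" by blast
  show thesis
  proof (rule that[OF U(1) V])
    fix i j assume ij: "i < k" "j < k" "i \<noteq> j"
    show "cip k (mv k G (V i)) (U j) = 0"
    proof (cases "i < r")
      case True
      then have "lam i > 0" using lam0[of i] ij r_less[of i] by simp
      then have "w i = (\<lambda>j. of_real (sqrt (lam i)) * U i j)"
        using U(2)[OF True] by (simp add: U0_def)
      then have "cip k (w i) (U j) = of_real (sqrt (lam i)) * cip k (U i) (U j)"
        by (simp add: cip_scale_left)
      then show ?thesis using ij U(1) by (simp add: w_def orthonormal_family_def)
    next
      case False
      then have "lam i \<le> 0" using dec[rule_format, of r i] r ij(1) by auto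
      then have "cip k (w i) (w i) = 0" using ww[of i i] ij lam0[of i] by simp
      then have "\<forall>j<k. w i j = 0" by (simp add: cip_self_eq_0_iff)
      then show ?thesis by (simp add: cip_def w_def)
    qed
  qed
qed

text \<open>
  Invariance of the trace of a compression under a change of orthonormal basis of the subspace.
\<close>

lemma rotate_frame:
  assumes U: "orthonormal_family (cip k) k U" and x: "orthonormal_family (cip n) k x"
  defines "x' \<equiv> \<lambda>i j. \<Sum>a<k. U i a * x a j"
  shows "orthonormal_family (cip n) k x'"
    and "(\<Sum>i<k. cip n (mv n A (x' i)) (x' i)) = (\<Sum>i<k. cip n (mv n A (x i)) (x i))"
proof -
  show "orthonormal_family (cip n) k x'"
    unfolding orthonormal_family_def
  proof (intro allI impI)
    fix i j assume ij: "i < k" "j < k"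
    have "cip n (x' i) (x' j) = (\<Sum>a<k. \<Sum>b<k. U i a * (cnj (U j b) * cip n (x a) (x b)))"
      by (simp add: x'_def cip_linear sum_distrib_left)
    also have "\<dots> = (\<Sum>a<k. \<Sum>b<k. if a = b then U i a * cnj (U j b) else 0)"
      using x by (intro sum.cong refl) (auto simp: orthonormal_family_def)
    also have "\<dots> = cip k (U i) (U j)"
      by (simp add: cip_def)
    finally show "cip n (x' i) (x' j) = (if i = j then 1 else 0)"
      using ij U by (simp add: orthonormal_family_def)
  qed
  define M where "M = (\<lambda>a b. cip n (mv n A (x a)) (x b))"
  have "cip n (mv n A (x' i)) (x' i) = (\<Sum>a<k. \<Sum>b<k. U i a * cnj (U i b) * M a b)" for i
    by (simp add: x'_def mv_sum mv_linear cip_linear sum_distrib_left mult.assoc M_def)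
  then have "(\<Sum>i<k. cip n (mv n A (x' i)) (x' i)) = (\<Sum>i<k. \<Sum>a<k. \<Sum>b<k. U i a * cnj (U i b) * M a b)"
    by simp
  also have "\<dots> = (\<Sum>a<k. \<Sum>b<k. (\<Sum>i<k. U i a * cnj (U i b)) * M a b)"
    unfolding sum_distrib_right
    by (subst sum.swap) (rule sum.cong[OF refl], rule sum.swap)
  also have "\<dots> = (\<Sum>a<k. \<Sum>b<k. if a = b then M a b else 0)"
    by (intro sum.cong refl) (simp add: unitary_columns[OF U])
  also have "\<dots> = (\<Sum>i<k. cip n (mv n A (x i)) (x i))"
    by (simp add: M_def)
  finally show "(\<Sum>i<k. cip n (mv n A (x' i)) (x' i)) = (\<Sum>i<k. cip n (mv n A (x i)) (x i))" .
qed

text \<open>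
  The two rotations come from a singular value decomposition of the matrix of inner products between
  the frames.
\<close>

lemma biorthogonal_frames:
  assumes x: "orthonormal_family (cip n) k x" and y: "orthonormal_family (cip n) k y"
  obtains x' y' where
    "orthonormal_family (cip n) k x'" "orthonormal_family (cip n) k y'"
    "\<forall>i<k. \<forall>j<k. i \<noteq> j \<longrightarrow> cip n (x' i) (y' j) = 0"
    "(\<Sum>i<k. cip n (mv n A (x' i)) (x' i)) = (\<Sum>i<k. cip n (mv n A (x i)) (x i))"
    "(\<Sum>i<k. cip n (mv n A (y' i)) (y' i)) = (\<Sum>i<k. cip n (mv n A (y i)) (y i))"
proof -
  define G where "G = (\<lambda>a b. cip n (y b) (x a))"
  obtain U V where U: "orthonormal_family (cip k) k U" and V: "orthonormal_family (cip k) k V"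
    and UV: "\<And>i j. i < k \<Longrightarrow> j < k \<Longrightarrow> i \<noteq> j \<Longrightarrow> cip k (mv k G (V i)) (U j) = 0"
    using singular_value_decomposition[of k G] by blast
  let ?x = "\<lambda>i j. \<Sum>a<k. U i a * x a j" and ?y = "\<lambda>i j. \<Sum>a<k. V i a * y a j"
  show thesis
  proof (rule that[of ?x ?y])
    show "\<forall>i<k. \<forall>j<k. i \<noteq> j \<longrightarrow> cip n (?x i) (?y j) = 0"
    proof (intro allI impI)
      fix i j assume ij: "i < k" "j < k" "i \<noteq> j"
      have "cip n (?y j) (?x i) = (\<Sum>b<k. \<Sum>a<k. V j b * (cnj (U i a) * cip n (y b) (x a)))"
        by (simp add: cip_linear sum_distrib_left)
      also have "\<dots> = cip k (mv k G (V j)) (U i)"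
        unfolding cip_def[of k] mv_def G_def sum_distrib_right
        by (subst sum.swap) (simp add: mult_ac)
      finally have "cip n (?y j) (?x i) = 0" using UV ij by simp
      then show "cip n (?x i) (?y j) = 0"
        using cip_commute[of n "?x i" "?y j"] by simp
    qed
  qed (rule rotate_frame[OF U x] rotate_frame[OF V y])+
qed

text \<open>
  Normalise the form affinely to a sesquilinear B with B x x = 0 and B y y = 1. A phase \<omega> makes
  B real along the path (1 - s) * \<omega> * x + s * y, so that after normalisation of the vectors its
  values run continuously from 0 to 1.
\<close>

lemma toeplitz_hausdorff:
  assumes x: "cip n x x = 1" and y: "cip n y y = 1" and t: "0 \<le> t" "t \<le> 1"
  obtains a b where "cip n (\<lambda>j. a * x j + b * y j) (\<lambda>j. a * x j + b * y j) = 1"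
    "cip n (mv n A (\<lambda>j. a * x j + b * y j)) (\<lambda>j. a * x j + b * y j) =
      of_real (1 - t) * cip n (mv n A x) x + of_real t * cip n (mv n A y) y"
proof (cases "cip n (mv n A x) x = cip n (mv n A y) y")
  case True
  show thesis
    by (rule that[of 1 0]) (use x True in \<open>simp_all add: algebra_simps\<close>)
next
  case False
  define \<alpha> where "\<alpha> = cip n (mv n A x) x"
  define \<beta> where "\<beta> = cip n (mv n A y) y"
  have ne: "\<beta> - \<alpha> \<noteq> 0" using False by (simp add: \<alpha>_def \<beta>_def)
  define B where "B = (\<lambda>u v. (cip n (mv n A u) v - \<alpha> * cip n u v) / (\<beta> - \<alpha>))"
  have Bl: "B (\<lambda>j. a * u j + b * v j) z = a * B u z + b * B v z" for a b u v z
    by (simp add: B_def mv_linear cip_linear divide_simps) (simp add: algebra_simps)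
  have Br: "B z (\<lambda>j. a * u j + b * v j) = cnj a * B z u + cnj b * B z v" for a b u v z
    by (simp add: B_def mv_linear cip_linear divide_simps) (simp add: algebra_simps)
  have Bxx: "B x x = 0" using x by (simp add: B_def \<alpha>_def)
  have Byy: "B y y = 1" using y ne by (simp add: B_def \<beta>_def)
  have Bnull: "B z v = 0" "B v z = 0" if "cip n z z = 0" for z v
  proof -
    have "\<forall>j<n. z j = 0" using that by (simp add: cip_self_eq_0_iff)
    then show "B z v = 0" "B v z = 0" by (simp_all add: B_def cip_def mv_def)
  qed
  define d where "d = B x y - cnj (B y x)"
  \<comment> \<open>B x y and B y x enter with conjugate phases; this phase cancels their imaginary parts\<close>
  define \<omega> where "\<omega> = (if d = 0 then 1 else cnj (sgn d))"
  have \<omega>: "cmod \<omega> = 1" by (simp add: \<omega>_def norm_sgn)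
  have "Im (\<omega> * d) = 0"
  proof (cases "d = 0")
    case False
    then have "\<omega> * d = d * cnj d / of_real (cmod d)"
      by (simp add: \<omega>_def sgn_div_norm scaleR_conv_of_real divide_inverse mult.commute mult.left_commute)
    also have "\<dots> = of_real (cmod d * cmod d / cmod d)"
      by (simp only: complex_norm_square[symmetric] power2_eq_square of_real_divide)
    finally have "\<omega> * d = of_real (cmod d * cmod d / cmod d)" .
    then show ?thesis by simp
  qed simp
  then have im: "Im (\<omega> * B x y + cnj \<omega> * B y x) = 0"
    by (simp add: d_def algebra_simps)
  define R where "R = Re (\<omega> * B x y + cnj \<omega> * B y x)"
  have R: "\<omega> * B x y + cnj \<omega> * B y x = of_real R"
    using im by (simp add: R_def complex_eq_iff)
  define z where "z = (\<lambda>s j. (of_real (1 - s) * \<omega>) * x j + of_real s * y j)"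
  have Bz: "B (z s) (z s) = of_real ((1 - s) * s * R + s\<^sup>2)" for s
  proof -
    have "B (z s) (z s) = of_real ((1 - s) * s) * (\<omega> * B x y + cnj \<omega> * B y x) + of_real (s\<^sup>2)"
      unfolding z_def Bl Br Bxx Byy by (simp add: algebra_simps power2_eq_square)
    then show ?thesis unfolding R by simp
  qed
  define N where "N = (\<lambda>s. Re (cip n (z s) (z s)))"
  have N: "cip n (z s) (z s) = of_real (N s)" for s
    unfolding N_def by (rule cip_self_Re)
  have Npos: "N s > 0" for s
  proof (rule ccontr)
    assume "\<not> ?thesis"
    then have "N s = 0" using cip_self_nonneg[of n "z s"] unfolding N_def by simp
    then have 0: "cip n (z s) (z s) = 0" using N by simp
    have 1: "B (z s) y = 0" "B (z s) x = 0" "B x (z s) = 0" using Bnull[OF 0] by auto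
    from 1 have 2: "of_real s * B y x = 0" "of_real (1 - s) * \<omega> * B x y + of_real s = 0"
      "of_real s * B x y = 0"
      unfolding z_def Bl Br Bxx Byy by simp_all
    show False
    proof (cases "s = 0")
      case True
      have "\<omega> * cnj \<omega> = 1" using \<omega> by (metis complex_norm_square of_real_1 power_one)
      then have "cip n (z s) (z s) = 1"
        using x by (simp add: z_def True cip_linear)
      then show False using 0 by simp
    next
      case False
      then have "B x y = 0" using 2(3) by simp
      then show False using 2(2) False by simp
    qed
  qed
  define f where "f = (\<lambda>s. ((1 - s) * s * R + s\<^sup>2) / N s)"
  have "continuous_on {0..1} N"
    unfolding N_def z_def
    by (intro continuous_on_Re continuous_on_cip continuous_intros)
  then have "continuous_on {0..1} f"
    unfolding f_def using Npos by (intro continuous_intros) (auto simp: less_imp_neq[symmetric])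
  moreover have "f 0 = 0" by (simp add: f_def)
  moreover have "f 1 = 1"
    using y by (simp add: f_def N_def z_def)
  ultimately obtain s where s: "0 \<le> s" "s \<le> 1" "f s = t"
    using IVT'[of f 0 t 1] t by auto
  define c where "c = complex_of_real (1 / sqrt (N s))"
  have c: "c * (cnj c * of_real (N s)) = 1"
    unfolding c_def complex_cnj_complex_of_real of_real_mult[symmetric] using Npos[of s] by simp
  let ?z = "\<lambda>j. (c * (of_real (1 - s) * \<omega>)) * x j + (c * of_real s) * y j"
  have z': "?z = (\<lambda>j. c * z s j)" by (simp add: z_def algebra_simps)
  have z1: "cip n ?z ?z = 1"
    unfolding z' cip_scale_left cip_scale_right N by (rule c)
  have "B ?z ?z = c * (cnj c * B (z s) (z s))"
    using Bl[of c "z s" 0 "z s" ] Br[of _ c "z s" 0 "z s"] unfolding z' by simp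
  also have "\<dots> = c * (cnj c * of_real (N s)) * of_real t"
    using s(3) Npos[of s] by (simp add: Bz f_def flip: s(3))
  also have "\<dots> = of_real t" by (simp add: c)
  finally have "cip n (mv n A ?z) ?z - \<alpha> = of_real t * (\<beta> - \<alpha>)"
    using ne z1 unfolding B_def by (simp add: field_simps)
  then have "cip n (mv n A ?z) ?z = of_real (1 - t) * \<alpha> + of_real t * \<beta>"
    by (simp add: algebra_simps)
  then show thesis
    using that[OF z1] unfolding \<alpha>_def \<beta>_def by blast
qed

text \<open>
  After the rotation, the vectors z i chosen in the spans of the pairs x i, y i are orthonormal, since
  these spans are mutually orthogonal.
\<close>

lemma convex_numerical_range: "convex (numerical_range (cip n) k (mv n A))"
  unfolding convex_alt
proof (intro ballI allI impI)
  fix v w t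
  assume "v \<in> numerical_range (cip n) k (mv n A)" "w \<in> numerical_range (cip n) k (mv n A)"
    and t: "0 \<le> t \<and> t \<le> (1::real)"
  then obtain x0 y0 where x0: "orthonormal_family (cip n) k x0"
    and v: "v = 1 / of_nat k * (\<Sum>i<k. cip n (mv n A (x0 i)) (x0 i))"
    and y0: "orthonormal_family (cip n) k y0"
    and w: "w = 1 / of_nat k * (\<Sum>i<k. cip n (mv n A (y0 i)) (y0 i))"
    unfolding numerical_range_def by blast
  obtain x y where x: "orthonormal_family (cip n) k x" and y: "orthonormal_family (cip n) k y"
    and xy: "\<forall>i<k. \<forall>j<k. i \<noteq> j \<longrightarrow> cip n (x i) (y j) = 0"
    and vx: "(\<Sum>i<k. cip n (mv n A (x i)) (x i)) = (\<Sum>i<k. cip n (mv n A (x0 i)) (x0 i))"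
    and wy: "(\<Sum>i<k. cip n (mv n A (y i)) (y i)) = (\<Sum>i<k. cip n (mv n A (y0 i)) (y0 i))"
    using biorthogonal_frames[OF x0 y0, of A] by blast
  have yx: "cip n (y i) (x j) = 0" if "i < k" "j < k" "i \<noteq> j" for i j
    using xy that cip_commute[of n "y i" "x j"] by simp
  define P where "P = (\<lambda>i a b. cip n (\<lambda>j. a * x i j + b * y i j) (\<lambda>j. a * x i j + b * y i j) = 1 \<and>
     cip n (mv n A (\<lambda>j. a * x i j + b * y i j)) (\<lambda>j. a * x i j + b * y i j) =
      of_real (1 - t) * cip n (mv n A (x i)) (x i) + of_real t * cip n (mv n A (y i)) (y i))"
  have "\<exists>a b. P i a b" if "i < k" for i
  proof -
    have "cip n (x i) (x i) = 1" "cip n (y i) (y i) = 1"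
      using x y that by (simp_all add: orthonormal_family_def)
    from toeplitz_hausdorff[OF this, of t A "\<exists>a b. P i a b"] t show ?thesis
      unfolding P_def by blast
  qed
  then obtain a b where P: "\<And>i. i < k \<Longrightarrow> P i (a i) (b i)"
    by metis
  note z1 = P[unfolded P_def, THEN conjunct1] and zA = P[unfolded P_def, THEN conjunct2]
  define z where "z = (\<lambda>i j. a i * x i j + b i * y i j)"
  have "orthonormal_family (cip n) k z"
    unfolding orthonormal_family_def
  proof (intro allI impI)
    fix i j assume ij: "i < k" "j < k"
    show "cip n (z i) (z j) = (if i = j then 1 else 0)"
    proof (cases "i = j")
      case True
      then show ?thesis using z1 ij by (simp add: z_def)
    next
      case False
      then show ?thesis using ij xy False yx[OF ij False] x y
        by (simp add: z_def cip_linear orthonormal_family_def)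
    qed
  qed
  moreover have "(1 - t) *\<^sub>R v + t *\<^sub>R w = 1 / of_nat k * (\<Sum>i<k. cip n (mv n A (z i)) (z i))"
  proof -
    have "(\<Sum>i<k. cip n (mv n A (z i)) (z i)) =
       of_real (1 - t) * (\<Sum>i<k. cip n (mv n A (x i)) (x i)) + of_real t * (\<Sum>i<k. cip n (mv n A (y i)) (y i))"
      unfolding z_def sum_distrib_left sum.distrib[symmetric] by (intro sum.cong refl zA) simp
    then show ?thesis
      unfolding vx wy v w scaleR_conv_of_real by (simp only: distrib_left mult.left_commute)
  qed
  ultimately show "(1 - t) *\<^sub>R v + t *\<^sub>R w \<in> numerical_range (cip n) k (mv n A)"
    unfolding numerical_range_def by blast
qed

section \<open>Coordinates for an abstract Hilbert space\<close>

context fin_dim_complex_hilbert_space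
begin

lemma ip_add_right: "ip x (y + z) = ip x y + ip x z"
proof -
  have "ip x (y + z) = cnj (ip (y + z) x)" by (rule ip_commute)
  also have "\<dots> = cnj (ip y x) + cnj (ip z x)" by (simp add: ip_add_left)
  finally show ?thesis by (simp only: ip_commute[symmetric])
qed

lemma ip_scale_right: "ip x (scale a y) = cnj a * ip x y"
proof -
  have "ip x (scale a y) = cnj (ip (scale a y) x)" by (rule ip_commute)
  also have "\<dots> = cnj a * cnj (ip y x)" by (simp add: ip_scale_left)
  finally show ?thesis by (simp only: ip_commute[symmetric])
qed

lemma ip_zero_left: "ip 0 y = 0"
  using ip_scale_left[of 0 0 y] by simp

lemma ip_zero_right: "ip y 0 = 0"
  using ip_scale_right[of y 0 0] by simp

lemma ip_sum_left: "ip (\<Sum>i\<in>I. f i) y = (\<Sum>i\<in>I. ip (f i) y)"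
  by (induction I rule: infinite_finite_induct) (simp_all add: ip_zero_left ip_add_left)

lemma ip_sum_right: "ip y (\<Sum>i\<in>I. f i) = (\<Sum>i\<in>I. ip y (f i))"
  by (induction I rule: infinite_finite_induct) (simp_all add: ip_zero_right ip_add_right)

lemma ip_combination_left:
  assumes "orthonormal_family ip m e" "i < m"
  shows "ip (\<Sum>j<m. scale (f j) (e j)) (e i) = f i"
proof -
  have "ip (\<Sum>j<m. scale (f j) (e j)) (e i) = (\<Sum>j<m. if j = i then f i else 0)"
    unfolding ip_sum_left ip_scale_left
    using assms by (intro sum.cong) (auto simp: orthonormal_family_def)
  then show ?thesis using assms(2) by simp
qed

lemma ip_combinations:
  assumes "orthonormal_family ip m e"
  shows "ip (\<Sum>j<m. scale (f j) (e j)) (\<Sum>j<m. scale (g j) (e j)) = cip m f g"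
  unfolding ip_sum_right[of "\<Sum>j<m. scale (f j) (e j)"] cip_def ip_scale_right
  using ip_combination_left[OF assms] by (intro sum.cong refl) (simp add: mult.commute)

lemma orthonormal_independent:
  assumes e: "orthonormal_family ip m e"
  shows "inj_on e {..<m}" and "independent (e ` {..<m})"
proof -
  show inj: "inj_on e {..<m}"
  proof (rule inj_onI)
    fix i j assume ij: "i \<in> {..<m}" "j \<in> {..<m}" "e i = e j"
    then have "ip (e i) (e j) = 1" using e by (simp add: orthonormal_family_def)
    then show "i = j" using e ij(1,2) by (auto simp: orthonormal_family_def split: if_splits)
  qed
  show "independent (e ` {..<m})"
  proof (rule independent_if_scalars_zero)
    fix f x assume 0: "(\<Sum>x\<in>e ` {..<m}. scale (f x) x) = 0" and "x \<in> e ` {..<m}"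
    then obtain i where i: "i < m" "x = e i" by auto
    have "(\<Sum>j<m. scale (f (e j)) (e j)) = 0"
      using 0 sum.reindex[OF inj, of "\<lambda>x. scale (f x) x"] by (simp add: o_def)
    then show "f x = 0"
      using ip_combination_left[OF e i(1), of "\<lambda>j. f (e j)"] i(2) by (simp add: ip_zero_left)
  qed simp
qed

text \<open>
  An orthonormal family of maximal size spans: otherwise the normalised residual of a vector outside
  the span would enlarge it.
\<close>

lemma orthonormal_basis_exists:
  assumes "dim UNIV = n"
  obtains e where "orthonormal_family ip n e" "\<And>x. x = (\<Sum>j<n. scale (ip x (e j)) (e j))"
proof -
  obtain S where S: "finite S" "span S = UNIV" using finite_spanning by blast
  define P where "P = (\<lambda>m. \<exists>e. orthonormal_family ip m e)"
  have bound: "m \<le> card S" if P: "P m" for m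
  proof -
    obtain e where e: "orthonormal_family ip m e" using P by (auto simp: P_def)
    have "card (e ` {..<m}) \<le> card S"
      using independent_span_bound[OF S(1) orthonormal_independent(2)[OF e]] S(2) by auto
    then show ?thesis using card_image[OF orthonormal_independent(1)[OF e]] by simp
  qed
  have "P 0" by (simp add: P_def orthonormal_family_def)
  then obtain m where m: "P m" "\<And>m'. P m' \<Longrightarrow> m' \<le> m"
    using Nat.ex_has_greatest_nat[of P 0 "card S"] bound by metis
  then obtain e where e: "orthonormal_family ip m e" by (auto simp: P_def)
  have exp: "x = (\<Sum>j<m. scale (ip x (e j)) (e j))" for x
  proof (rule ccontr)
    assume ne: "x \<noteq> (\<Sum>j<m. scale (ip x (e j)) (e j))"
    define r where "r = x + scale (-1) (\<Sum>j<m. scale (ip x (e j)) (e j))"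
    have "r \<noteq> 0" using ne by (simp add: r_def)
    have re: "ip r (e i) = 0" if "i < m" for i
      unfolding r_def ip_add_left ip_scale_left ip_combination_left[OF e that] by simp
    define q where "q = Re (ip r r)"
    have "Im (ip r r) = 0"
      using arg_cong[OF ip_commute[of r r], of Im] by simp
    then have q: "ip r r = of_real q" by (simp add: q_def complex_eq_iff)
    have "q \<ge> 0" unfolding q_def by (rule ip_self_nonneg)
    moreover have "q \<noteq> 0" using ip_self_eq_0[of r] \<open>r \<noteq> 0\<close> q by auto
    ultimately have "q > 0" by simp
    define v where "v = scale (of_real (1 / sqrt q)) r"
    have vv: "ip v v = 1"
      unfolding v_def ip_scale_left ip_scale_right q complex_cnj_complex_of_real of_real_mult[symmetric]
      using \<open>q > 0\<close> by simp
    have ve: "ip v (e i) = 0" "ip (e i) v = 0" if "i < m" for i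
    proof -
      show "ip v (e i) = 0" unfolding v_def ip_scale_left using re[OF that] by simp
      then show "ip (e i) v = 0" using ip_commute[of "e i" v] by simp
    qed
    have "orthonormal_family ip (Suc m) (e(m := v))"
      unfolding orthonormal_family_def
    proof (intro allI impI)
      fix i j assume "i < Suc m" "j < Suc m"
      then show "ip ((e(m := v)) i) ((e(m := v)) j) = (if i = j then 1 else 0)"
        using vv ve e by (cases "i = m"; cases "j = m") (auto simp: orthonormal_family_def)
    qed
    then have "P (Suc m)" unfolding P_def by blast
    from m(2)[OF this] show False by simp
  qed
  have "span (e ` {..<m}) = UNIV"
  proof -
    have "x \<in> span (e ` {..<m})" for x
    proof -
      have "(\<Sum>j<m. scale (ip x (e j)) (e j)) \<in> span (e ` {..<m})"
        by (intro span_sum span_scale span_base) simp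
      then show ?thesis by (simp only: exp[of x, symmetric])
    qed
    then show ?thesis by blast
  qed
  then have "dim UNIV = card (e ` {..<m})"
    using dim_eq_card[of "e ` {..<m}" UNIV] orthonormal_independent(2)[OF e] by (simp add: span_UNIV)
  then have mn: "m = n"
    using assms card_image[OF orthonormal_independent(1)[OF e]] by simp
  show thesis
    by (rule that[OF e[unfolded mn] exp[unfolded mn]])
qed

lemma numerical_range_coordinates:
  assumes "dim UNIV = n" and c: "Vector_Spaces.linear scale scale c"
  obtains A where "numerical_range ip k c = numerical_range (cip n) k (mv n A)"
proof -
  interpret c: Vector_Spaces.linear scale scale c by (rule c)
  obtain e where e: "orthonormal_family ip n e" and exp: "\<And>x. x = (\<Sum>j<n. scale (ip x (e j)) (e j))"
    using orthonormal_basis_exists[OF assms(1)] by blast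
  define A where "A = (\<lambda>i j. ip (c (e j)) (e i))"
  \<comment> \<open>E and \<phi> are the mutually inverse passages from coordinates to vectors and back\<close>
  define E where "E = (\<lambda>f. \<Sum>j<n. scale (f j) (e j))"
  define \<phi> where "\<phi> = (\<lambda>x j. ip x (e j))"
  have E\<phi>: "E (\<phi> x) = x" for x unfolding E_def \<phi>_def by (rule exp[symmetric])
  have ipE: "ip (E f) (E g) = cip n f g" for f g unfolding E_def by (rule ip_combinations[OF e])
  have cE: "ip (c (E f)) (E g) = cip n (mv n A f) g" for f g
  proof -
    have "\<phi> (c (E f)) = mv n A f"
      unfolding \<phi>_def E_def c.sum c.scale ip_sum_left ip_scale_left mv_def A_def
      by (simp add: mult.commute)
    then have "c (E f) = E (mv n A f)" using E\<phi>[of "c (E f)"] by simp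
    then show ?thesis by (simp add: ipE)
  qed
  have "numerical_range ip k c = numerical_range (cip n) k (mv n A)"
  proof (intro equalityI subsetI)
    fix w assume "w \<in> numerical_range ip k c"
    then obtain x where x: "orthonormal_family ip k x"
      and w: "w = 1 / of_nat k * (\<Sum>i<k. ip (c (x i)) (x i))"
      unfolding numerical_range_def by blast
    have "orthonormal_family (cip n) k (\<lambda>i. \<phi> (x i))"
      using x unfolding orthonormal_family_def ipE[symmetric] E\<phi> .
    moreover have "w = 1 / of_nat k * (\<Sum>i<k. cip n (mv n A (\<phi> (x i))) (\<phi> (x i)))"
      unfolding cE[symmetric] E\<phi> by (rule w)
    ultimately show "w \<in> numerical_range (cip n) k (mv n A)"
      unfolding numerical_range_def by (intro CollectI exI[of _ "\<lambda>i. \<phi> (x i)"] conjI)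
  next
    fix w assume "w \<in> numerical_range (cip n) k (mv n A)"
    then obtain x where x: "orthonormal_family (cip n) k x"
      and w: "w = 1 / of_nat k * (\<Sum>i<k. cip n (mv n A (x i)) (x i))"
      unfolding numerical_range_def by blast
    have "orthonormal_family ip k (\<lambda>i. E (x i))"
      using x unfolding orthonormal_family_def ipE .
    moreover have "w = 1 / of_nat k * (\<Sum>i<k. ip (c (E (x i))) (E (x i)))"
      unfolding cE by (rule w)
    ultimately show "w \<in> numerical_range ip k c"
      unfolding numerical_range_def by (intro CollectI exI[of _ "\<lambda>i. E (x i)"] conjI)
  qed
  then show thesis by (rule that)
qed

end

section \<open>Algebraic functions and squarefree polynomials\<close>

definition eval2 :: "complex poly poly \<Rightarrow> complex \<Rightarrow> complex \<Rightarrow> complex" where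
  "eval2 F z w = poly (poly F [:w:]) z"

lemma eval2_simps:
  "eval2 (F + G) z w = eval2 F z w + eval2 G z w"
  "eval2 (F * G) z w = eval2 F z w * eval2 G z w"
  "eval2 [:d:] z w = poly d z"
  by (simp_all add: eval2_def)

text \<open>
  A polynomial with coefficients in \<complex>[z] can be evaluated first at z or first at w.
\<close>

lemma eval2_map_poly: "eval2 F z w = poly (map_poly (\<lambda>p. poly p z) F) w"
  by (induction F) (simp_all add: eval2_def map_poly_pCons mult.commute)

text \<open>
  The polynomial is the characteristic polynomial of M over the ring \<complex>[z], which specialises to
  the characteristic polynomial at each z. An arbitrary finite index set is allowed because the
  matrix of interest is indexed by functions.
\<close>

lemma eigenvalue_algebraic:
  fixes M :: "'i \<Rightarrow> 'i \<Rightarrow> complex poly"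
  assumes "finite I"
  obtains F where "lead_coeff F = 1"
    "\<forall>z s v. (\<exists>i\<in>I. v i \<noteq> 0) \<longrightarrow> (\<forall>i\<in>I. (\<Sum>j\<in>I. poly (M i j) z * v j) = s * v i) \<longrightarrow> eval2 F z s = 0"
proof -
  define N where "N = card I"
  obtain f where f: "bij_betw f {0..<N} I"
    using ex_bij_betw_nat_finite[OF assms] unfolding N_def by blast
  define A where "A = mat N N (\<lambda>(a, b). M (f a) (f b))"
  have A: "A \<in> carrier_mat N N" by (simp add: A_def)
  show thesis
  proof (rule that)
    show "lead_coeff (char_poly A) = 1" using degree_monic_char_poly[OF A] by simp
  next
    show "\<forall>z s v. (\<exists>i\<in>I. v i \<noteq> 0) \<longrightarrow> (\<forall>i\<in>I. (\<Sum>j\<in>I. poly (M i j) z * v j) = s * v i)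
        \<longrightarrow> eval2 (char_poly A) z s = 0"
    proof (intro allI impI)
      fix z s v assume v: "\<exists>i\<in>I. v i \<noteq> 0" and ev: "\<forall>i\<in>I. (\<Sum>j\<in>I. poly (M i j) z * v j) = s * v i"
      define B where "B = map_mat (\<lambda>p. poly p z) A"
      have B: "B \<in> carrier_mat N N" by (simp add: B_def A)
      define x where "x = vec N (\<lambda>a. v (f a))"
      have "x \<noteq> 0\<^sub>v N"
      proof
        assume 0: "x = 0\<^sub>v N"
        obtain i where i: "i \<in> I" "v i \<noteq> 0" using v by blast
        then obtain a where a: "a < N" "f a = i"
          using bij_betw_imp_surj_on[OF f] by force
        have "x $ a = 0" using 0 a(1) by simp
        then show False using a i by (simp add: x_def)
      qed
      moreover have "B *\<^sub>v x = s \<cdot>\<^sub>v x"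
      proof (rule eq_vecI)
        fix a assume "a < dim_vec (s \<cdot>\<^sub>v x)"
        then have a: "a < N" by (simp add: x_def)
        then have "f a \<in> I" using bij_betwE[OF f] by simp
        have "(B *\<^sub>v x) $ a = (\<Sum>b\<in>{0..<N}. poly (M (f a) (f b)) z * v (f b))"
          using a by (simp add: B_def A_def x_def scalar_prod_def)
        also have "\<dots> = (\<Sum>j\<in>I. poly (M (f a) j) z * v j)"
          by (rule sum.reindex_bij_betw[OF f])
        also have "\<dots> = s * v (f a)" using ev \<open>f a \<in> I\<close> by blast
        finally show "(B *\<^sub>v x) $ a = (s \<cdot>\<^sub>v x) $ a" using a by (simp add: x_def)
      qed (simp add: B_def A_def x_def)
      ultimately have "eigenvalue B s"
        unfolding eigenvalue_def eigenvector_def using B by (intro exI[of _ x]) (auto simp: x_def)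
      then have "poly (char_poly B) s = 0" using eigenvalue_root_char_poly[OF B] by simp
      moreover have "char_poly B = map_poly (\<lambda>p. poly p z) (char_poly A)"
        unfolding B_def by (rule poly_hom.char_poly_hom[OF A])
      ultimately show "eval2 (char_poly A) z s = 0" by (simp add: eval2_map_poly)
    qed
  qed
qed

text \<open>
  Let G be a nonzero element of least w-degree in the ideal generated by S and its derivative.
  Pseudo-division shows that G divides both generators up to factors from \<complex>[z]. If the degree of
  G were positive, a prime factor of its primitive part would divide S and its derivative, and so its
  square would divide S.
\<close>

lemma squarefree_bezout:
  fixes S :: "complex poly poly"
  assumes unit: "is_unit (lead_coeff S)"
    and sqf: "\<And>q t. prime q \<Longrightarrow> degree q > 0 \<Longrightarrow> S = q * (q * t) \<Longrightarrow> False"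
  obtains A B d where "d \<noteq> 0" "[:d:] = A * S + B * pderiv S"
proof -
  have "S \<noteq> 0" using unit by auto
  define J where "J = (\<lambda>G. G \<noteq> 0 \<and> (\<exists>A B. G = A * S + B * pderiv S))"
  have "S = 1 * S + 0 * pderiv S" by simp
  then have "J S" unfolding J_def using \<open>S \<noteq> 0\<close> by blast
  then obtain G where G: "J G" and min: "\<And>G'. J G' \<Longrightarrow> degree G \<le> degree G'"
    using ex_has_least_nat[of J S degree] by blast
  obtain A B where AB: "G = A * S + B * pderiv S" using G unfolding J_def by blast
  have "degree G = 0"
  proof (rule ccontr)
    assume deg: "degree G \<noteq> 0"
    have G0: "G \<noteq> 0" using G unfolding J_def by blast
    have pseudo: "\<exists>c. c \<noteq> 0 \<and> G dvd Polynomial.smult c T" if T: "T = A' * S + B' * pderiv S" for T A' B'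
    proof -
      obtain q r where qr: "pseudo_divmod T G = (q, r)" by (cases "pseudo_divmod T G") auto
      define c where "c = coeff G (degree G) ^ (Suc (degree T) - degree G)"
      have c: "Polynomial.smult c T = G * q + r" and r: "r = 0 \<or> degree r < degree G"
        using pseudo_divmod[OF G0 qr] by (auto simp: c_def)
      have "c \<noteq> 0" using G0 by (simp add: c_def)
      have "r = 0"
      proof (rule ccontr)
        assume "r \<noteq> 0"
        have "r = Polynomial.smult c T - G * q" using c by simp
        also have "\<dots> = (Polynomial.smult c A' - A * q) * S + (Polynomial.smult c B' - B * q) * pderiv S"
          unfolding T AB by (simp add: algebra_simps smult_add_right)
        finally have "J r" using \<open>r \<noteq> 0\<close> unfolding J_def by blast
        then show False using min[of r] r \<open>r \<noteq> 0\<close> by simp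
      qed
      then show ?thesis using c \<open>c \<noteq> 0\<close> by (intro exI[of _ c]) simp
    qed
    obtain c1 where c1: "c1 \<noteq> 0" "G dvd Polynomial.smult c1 S" using pseudo[of S 1 0] by auto
    obtain c2 where c2: "c2 \<noteq> 0" "G dvd Polynomial.smult c2 (pderiv S)" using pseudo[of "pderiv S" 0 1] by auto
    define P where "P = primitive_part G"
    have P: "P dvd G" "degree P \<noteq> 0" "content P = 1" "P \<noteq> 0"
      using deg G0 content_times_primitive_part[of G] dvd_smult[OF dvd_refl, of P "content G"]
      by (auto simp: P_def)
    have "\<not> is_unit P" using P(2) by (auto dest: is_unit_poly_iff[THEN iffD1])
    then obtain q where q: "q dvd P" "prime q" using prime_divisor_exists[OF P(4)] by blast
    have dq: "degree q > 0"
    proof (rule ccontr)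
      assume "\<not> degree q > 0"
      then obtain a where a: "q = [:a:]" by (auto elim: degree_eq_zeroE)
      then have "is_unit a" using q(1) P(3) const_poly_dvd_iff_dvd_content[of a P] by simp
      then have "is_unit q" using a is_unit_const_poly_iff by blast
      then show False using q(2) not_prime_unit by blast
    qed
    have q_dvd: "q dvd T" if "c \<noteq> 0" "G dvd Polynomial.smult c T" for c T
    proof -
      have "q dvd Polynomial.smult c T" using q(1) P(1) that(2) by (meson dvd_trans)
      then have "q dvd [:c:] * T" by simp
      moreover have "\<not> q dvd [:c:]"
        using dvd_imp_degree_le[of q "[:c:]"] dq that(1) by auto
      ultimately show ?thesis using q(2) by (simp only: prime_dvd_mult_iff) simp
    qed
    obtain t where t: "S = q * t" using q_dvd[OF c1] by (auto elim: dvdE)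
    have "q dvd pderiv S" by (rule q_dvd[OF c2])
    then have "q dvd t * pderiv q"
      unfolding t pderiv_mult by (metis dvd_add_right_iff dvd_triv_left)
    moreover have "\<not> q dvd pderiv q"
    proof
      assume "q dvd pderiv q"
      moreover have "pderiv q \<noteq> 0" using dq by (simp add: pderiv_eq_0_iff)
      ultimately have "degree q \<le> degree (pderiv q)" by (rule dvd_imp_degree_le)
      then show False using dq degree_pderiv_le[of q] by (simp add: degree_pderiv)
    qed
    ultimately have "q dvd t" using q(2) by (simp only: prime_dvd_mult_iff) simp
    then obtain t' where "t = q * t'" by (auto elim: dvdE)
    then show False using sqf[OF q(2) dq] t by blast
  qed
  then obtain d where "G = [:d:]" by (auto elim: degree_eq_zeroE)
  then show thesis using that[of d A B] G AB unfolding J_def by auto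
qed

text \<open>
  Among the polynomials that vanish on Z and have a constant leading coefficient, one of least degree
  is squarefree, since removing a repeated factor preserves both properties. The constant leading
  coefficient keeps the number of roots in w the same for all z.
\<close>

lemma simple_root_polynomial:
  fixes Z :: "(complex \<times> complex) set"
  assumes F: "lead_coeff F = 1" "\<forall>(z, w)\<in>Z. eval2 F z w = 0"
  obtains S c D where "c \<noteq> 0" "lead_coeff S = [:c:]" "\<forall>(z, w)\<in>Z. eval2 S z w = 0"
    "D \<noteq> 0" "\<forall>z w. eval2 S z w = 0 \<longrightarrow> poly D z \<noteq> 0 \<longrightarrow> eval2 (pderiv S) z w \<noteq> 0"
proof -
  define Q where "Q = (\<lambda>S. is_unit (lead_coeff S) \<and> (\<forall>z w. (z, w) \<in> Z \<longrightarrow> eval2 S z w = 0))"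
  have "Q F" unfolding Q_def F(1) using F(2) by auto
  then obtain S where S: "Q S" and min: "\<And>T. Q T \<Longrightarrow> degree S \<le> degree T"
    using ex_has_least_nat[of Q F degree] by blast
  have unit: "is_unit (lead_coeff S)" and van: "\<And>z w. (z, w) \<in> Z \<Longrightarrow> eval2 S z w = 0"
    using S by (auto simp: Q_def)
  have "S \<noteq> 0" using unit by auto
  have sqf: False if "prime q" "degree q > 0" and t: "S = q * (q * t)" for q t
  proof -
    have "is_unit (lead_coeff (q * t))"
      using unit unfolding t lead_coeff_mult[of q "q * t"] is_unit_mult_iff by blast
    moreover have "eval2 (q * t) z w = 0" if "(z, w) \<in> Z" for z w
      using van[OF that] unfolding t by (auto simp: eval2_simps)
    ultimately have "degree S \<le> degree (q * t)" by (intro min) (simp add: Q_def)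
    moreover have "degree S = degree q + degree (q * t)"
      unfolding t using \<open>S \<noteq> 0\<close> t by (intro degree_mult_eq) auto
    ultimately show False using \<open>degree q > 0\<close> by simp
  qed
  obtain A B d where d: "d \<noteq> 0" "[:d:] = A * S + B * pderiv S"
    by (rule squarefree_bezout[OF unit sqf])
  have "degree (lead_coeff S) = 0" using unit \<open>S \<noteq> 0\<close> by (simp add: is_unit_iff_degree)
  then obtain c where c1: "lead_coeff S = [:c:]" by (rule degree_eq_zeroE)
  have c2: "c \<noteq> 0" using c1 \<open>S \<noteq> 0\<close> by (metis leading_coeff_0_iff pCons_0_0)
  have "eval2 (pderiv S) z w \<noteq> 0" if "eval2 S z w = 0" "poly d z \<noteq> 0" for z w
  proof
    assume "eval2 (pderiv S) z w = 0"
    then have "eval2 [:d:] z w = 0" unfolding d(2) using that(1) by (simp add: eval2_simps)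
    then show False using that(2) by (simp add: eval2_simps)
  qed
  then show thesis
    using that[OF c2 c1 _ d(1)] van by blast
qed

section \<open>Analytic continuation along a simple root\<close>

text \<open>
  The difference quotient in w of a polynomial in two variables, which is again a polynomial.
\<close>

definition dq2 :: "complex poly poly \<Rightarrow> complex \<Rightarrow> complex \<Rightarrow> complex \<Rightarrow> complex" where
  "dq2 S z w w' = (\<Sum>i\<le>degree S. poly (coeff S i) z * (\<Sum>j<i. w' ^ (i - Suc j) * w ^ j))"

lemma eval2_altdef: "eval2 S z w = (\<Sum>i\<le>degree S. poly (coeff S i) z * w ^ i)"
  unfolding eval2_def poly_altdef[of S] by (simp add: poly_sum)

lemma eval2_diff: "eval2 S z w - eval2 S z w' = dq2 S z w w' * (w - w')"
  unfolding eval2_altdef dq2_def sum_subtractf[symmetric] sum_distrib_right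
  by (intro sum.cong refl, subst right_diff_distrib[symmetric], subst power_diff_sumr2)
    (simp only: mult_ac)

lemma continuous_on_dq2: "continuous_on UNIV (\<lambda>(z, w, w'). dq2 S z w w')"
  unfolding dq2_def case_prod_unfold by (intro continuous_intros)

lemma dq2_diagonal: "dq2 S z w w = eval2 (pderiv S) z w"
proof -
  let ?p = "map_poly (\<lambda>p. poly p z) S"
  have "continuous_on UNIV (\<lambda>v. dq2 S z v w)"
    unfolding dq2_def by (intro continuous_intros)
  then have "isCont (\<lambda>v. dq2 S z v w) w" by (simp add: continuous_on_eq_continuous_at)
  then have "DERIV (poly ?p) w :> dq2 S z w w"
    unfolding CARAT_DERIV using eval2_diff[of S z _ w, unfolded eval2_map_poly]
    by (intro exI[of _ "\<lambda>v. dq2 S z v w"]) blast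
  moreover have "DERIV (poly ?p) w :> poly (pderiv ?p) w" by (rule poly_DERIV)
  ultimately have "dq2 S z w w = poly (pderiv ?p) w" by (rule DERIV_unique)
  also have "pderiv ?p = map_poly (\<lambda>p. poly p z) (pderiv S)"
    by (simp add: poly_hom.map_poly_pderiv)
  finally show ?thesis by (simp add: eval2_map_poly)
qed

lemma prod_mset_norm_ge:
  fixes A :: "complex multiset"
  assumes "\<forall>x\<in>#A. \<epsilon> \<le> cmod (w - x)" "\<epsilon> \<ge> 0"
  shows "\<epsilon> ^ size A \<le> cmod (poly (\<Prod>x\<in>#A. [:- x, 1:]) w)"
  using assms(1)
proof (induction A)
  case (add x A)
  have "\<epsilon> * \<epsilon> ^ size A \<le> cmod (w - x) * cmod (poly (\<Prod>x\<in>#A. [:- x, 1:]) w)"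
    using add assms(2) by (intro mult_mono) auto
  also have "\<dots> = cmod (poly (\<Prod>x\<in>#add_mset x A. [:- x, 1:]) w)"
    unfolding norm_mult[symmetric] by (simp add: algebra_simps)
  finally show ?case by simp
qed simp

text \<open>
  If all roots were at distance at least \<epsilon> from w, the factorisation into linear factors would make
  the value at w at least as large as the right-hand side.
\<close>

lemma exists_near_root:
  fixes p :: "complex poly"
  assumes "cmod (poly p w) < cmod (lead_coeff p) * \<epsilon> ^ degree p" "\<epsilon> > 0"
  obtains x where "poly p x = 0" "cmod (w - x) < \<epsilon>"
proof -
  have "p \<noteq> 0" using assms by auto
  then obtain A where A: "size A = degree p" "p = Polynomial.smult (lead_coeff p) (\<Prod>x\<in>#A. [:- x, 1:])"
    using alg_closed_imp_factorization by blast
  have "\<exists>x\<in>#A. cmod (w - x) < \<epsilon>"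
  proof (rule ccontr)
    assume "\<not> ?thesis"
    then have "\<epsilon> ^ size A \<le> cmod (poly (\<Prod>x\<in>#A. [:- x, 1:]) w)"
      using assms(2) by (intro prod_mset_norm_ge) auto
    then have "cmod (lead_coeff p) * \<epsilon> ^ degree p
        \<le> cmod (lead_coeff p) * cmod (poly (\<Prod>x\<in>#A. [:- x, 1:]) w)"
      unfolding A(1) by (rule mult_left_mono) simp
    also have "\<dots> = cmod (poly p w)"
      by (subst (3) A(2)) (simp add: norm_mult)
    finally show False using assms(1) by simp
  qed
  then obtain x where x: "x \<in># A" "cmod (w - x) < \<epsilon>" by blast
  have "poly p x = 0"
    by (subst A(2)) (use x(1) in \<open>auto simp: poly_prod_mset prod_mset_zero_iff image_iff\<close>)
  then show thesis using x(2) that by blast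
qed

text \<open>
  A holomorphic implicit function theorem. Near a simple root the difference quotient dq2 is bounded
  away from zero, which gives uniqueness of the root near w0; existence follows from
  exists_near_root because the leading coefficient is constant. The identity eval2_diff then shows
  that the root is continuous in z and complex differentiable.
\<close>

lemma holomorphic_simple_root:
  assumes c: "c \<noteq> 0" "lead_coeff S = [:c:]"
    and S0: "eval2 S z0 w0 = 0" and S1: "eval2 (pderiv S) z0 w0 \<noteq> 0"
  obtains r \<epsilon> g where "r > 0" "\<epsilon> > 0" "g holomorphic_on ball z0 r"
    "\<forall>z\<in>ball z0 r. \<forall>w\<in>ball w0 \<epsilon>. eval2 S z w = 0 \<longrightarrow> w = g z"
proof -
  define m where "m = cmod (dq2 S z0 w0 w0) / 2"
  have "m > 0" using S1 by (simp add: m_def dq2_diagonal)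
  let ?U = "{(z, w, w'). m < cmod (dq2 S z w w')}"
  have "open ?U"
    using continuous_on_dq2[of S] unfolding case_prod_unfold
    by (intro open_Collect_less continuous_intros) auto
  moreover have "(z0, w0, w0) \<in> ?U" using \<open>m > 0\<close> by (simp add: m_def)
  ultimately obtain A U' where A: "open A" "open U'" "z0 \<in> A" "(w0, w0) \<in> U'" "A \<times> U' \<subseteq> ?U"
    by (rule open_prod_elim) auto
  obtain C C' where C: "open C" "open C'" "w0 \<in> C" "w0 \<in> C'" "C \<times> C' \<subseteq> U'"
    using A(2,4) by (rule open_prod_elim) auto
  obtain r1 where r1: "r1 > 0" "ball z0 r1 \<subseteq> A" using A(1,3) openE by blast
  have "open (C \<inter> C')" "w0 \<in> C \<inter> C'" using C by auto
  then obtain \<epsilon> where \<epsilon>: "\<epsilon> > 0" "ball w0 \<epsilon> \<subseteq> C \<inter> C'" using openE by blast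
  have big: "m < cmod (dq2 S z w w')" if "z \<in> ball z0 r1" "w \<in> ball w0 \<epsilon>" "w' \<in> ball w0 \<epsilon>" for z w w'
  proof -
    have "(z, w, w') \<in> A \<times> U'" using that r1(2) \<epsilon>(2) C(5) by blast
    then show ?thesis using A(5) by auto
  qed
  have "\<forall>\<^sub>F z in at z0. dist (eval2 S z w0) 0 < cmod c * \<epsilon> ^ degree S"
  proof (rule tendstoD)
    have "isCont (\<lambda>z. eval2 S z w0) z0" unfolding eval2_def by (rule poly_isCont)
    then show "((\<lambda>z. eval2 S z w0) \<longlongrightarrow> 0) (at z0)" using S0 by (simp add: isCont_def)
    show "0 < cmod c * \<epsilon> ^ degree S" using c(1) \<epsilon>(1) by simp
  qed
  then obtain r2 where r2: "r2 > 0"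
    "\<And>z. z \<noteq> z0 \<Longrightarrow> dist z z0 < r2 \<Longrightarrow> cmod (eval2 S z w0) < cmod c * \<epsilon> ^ degree S"
    unfolding eventually_at by auto
  define r where "r = min r1 r2"
  have "r > 0" using r1(1) r2(1) by (simp add: r_def)
  have ex: "\<exists>w\<in>ball w0 \<epsilon>. eval2 S z w = 0" if "z \<in> ball z0 r" for z
  proof -
    let ?p = "map_poly (\<lambda>p. poly p z) S"
    have "coeff ?p (degree S) = c" using c(2) by (simp add: coeff_map_poly)
    then have deg: "degree ?p = degree S"
      using c(1) by (intro antisym degree_map_poly_le le_degree) simp
    have "lead_coeff ?p = c" unfolding deg by fact
    note lc = deg this
    have "cmod (poly ?p w0) < cmod (lead_coeff ?p) * \<epsilon> ^ degree ?p"
    proof (cases "z = z0")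
      case True
      then show ?thesis unfolding lc using S0 c \<epsilon>(1) by (simp add: eval2_map_poly)
    next
      case False
      then show ?thesis unfolding lc using r2(2)[of z] that
        by (simp add: eval2_map_poly r_def dist_commute c(2))
    qed
    from exists_near_root[OF this \<epsilon>(1)] obtain x where "poly ?p x = 0" "cmod (w0 - x) < \<epsilon>" by blast
    then show ?thesis by (intro bexI[of _ x]) (auto simp: eval2_map_poly dist_norm)
  qed
  have uniq: "w = w'" if "z \<in> ball z0 r" "w \<in> ball w0 \<epsilon>" "w' \<in> ball w0 \<epsilon>"
    "eval2 S z w = 0" "eval2 S z w' = 0" for z w w'
  proof -
    have "dq2 S z w w' * (w - w') = 0" using eval2_diff[of S z w w'] that by simp
    moreover have "dq2 S z w w' \<noteq> 0" using big[of z w w'] that \<open>m > 0\<close> by (auto simp: r_def)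
    ultimately show ?thesis by simp
  qed
  define g where "g = (\<lambda>z. SOME w. w \<in> ball w0 \<epsilon> \<and> eval2 S z w = 0)"
  have g: "g z \<in> ball w0 \<epsilon>" "eval2 S z (g z) = 0" if "z \<in> ball z0 r" for z
    using someI_ex[of "\<lambda>w. w \<in> ball w0 \<epsilon> \<and> eval2 S z w = 0"] ex[OF that] unfolding g_def by blast+
  have "\<exists>g'. (g has_field_derivative g') (at z1)" if z1: "z1 \<in> ball z0 r" for z1
  proof -
    define \<phi> where "\<phi> = (\<lambda>z. eval2 S z (g z1))"
    define B where "B = (\<lambda>z. dq2 S z (g z) (g z1))"
    have \<phi>: "DERIV \<phi> z1 :> poly (pderiv (poly S [:g z1:])) z1"
      unfolding \<phi>_def eval2_def by (rule poly_DERIV)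
    have near: "\<forall>\<^sub>F z in at z1. z \<in> ball z0 r"
      using z1 by (intro eventually_at_in_open') auto
    have key: "\<phi> z - \<phi> z1 = - (B z * (g z - g z1))" if "z \<in> ball z0 r" for z
      using eval2_diff[of S z "g z" "g z1"] g(2)[OF that] g(2)[OF z1]
      by (simp add: \<phi>_def B_def) (metis minus_minus)
    have Bm: "m < cmod (B z)" if "z \<in> ball z0 r" for z
      unfolding B_def using that z1 by (intro big g) (auto simp: r_def)
    have "(\<phi> \<longlongrightarrow> \<phi> z1) (at z1)" using DERIV_isCont[OF \<phi>] by (simp add: isCont_def)
    then have "((\<lambda>z. cmod (\<phi> z - \<phi> z1) / m) \<longlongrightarrow> cmod (\<phi> z1 - \<phi> z1) / m) (at z1)"
      using \<open>m > 0\<close> by (intro tendsto_intros) auto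
    then have "((\<lambda>z. cmod (\<phi> z - \<phi> z1) / m) \<longlongrightarrow> 0) (at z1)" by simp
    moreover have "\<forall>\<^sub>F z in at z1. norm (g z - g z1) \<le> cmod (\<phi> z - \<phi> z1) / m"
      using near
    proof eventually_elim
      case (elim z)
      have "m * cmod (g z - g z1) \<le> cmod (B z) * cmod (g z - g z1)"
        using Bm[OF elim] by (intro mult_right_mono) auto
      also have "\<dots> = cmod (\<phi> z - \<phi> z1)" unfolding key[OF elim] by (simp add: norm_mult)
      finally show ?case using \<open>m > 0\<close> by (simp add: field_simps)
    qed
    ultimately have "((\<lambda>z. g z - g z1) \<longlongrightarrow> 0) (at z1)" by (rule Lim_null_comparison[rotated])
    then have gc: "(g \<longlongrightarrow> g z1) (at z1)" by (simp add: LIM_zero_iff)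
    have "isCont (\<lambda>(z, w, w'). dq2 S z w w') (z1, g z1, g z1)"
      using continuous_on_dq2[of S] by (simp add: continuous_on_eq_continuous_at)
    then have "((\<lambda>z. (\<lambda>(z, w, w'). dq2 S z w w') (z, g z, g z1)) \<longlongrightarrow> dq2 S z1 (g z1) (g z1)) (at z1)"
      by (intro isCont_tendsto_compose[where g = "\<lambda>(z, w, w'). dq2 S z w w'" and l = "(z1, g z1, g z1)", simplified])
        (auto intro!: tendsto_intros gc)
    then have Bc: "(B \<longlongrightarrow> B z1) (at z1)" by (simp add: B_def)
    have "((\<lambda>z. - ((\<phi> z - \<phi> z1) / (z - z1)) / B z) \<longlongrightarrow> - poly (pderiv (poly S [:g z1:])) z1 / B z1) (at z1)"
      using \<phi> Bm[OF z1] \<open>m > 0\<close> unfolding has_field_derivative_iff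
      by (intro tendsto_intros Bc) auto
    moreover have "\<forall>\<^sub>F z in at z1. - ((\<phi> z - \<phi> z1) / (z - z1)) / B z = (g z - g z1) / (z - z1)"
      using near
    proof eventually_elim
      case (elim z)
      have "B z \<noteq> 0" using Bm[OF elim] \<open>m > 0\<close> by auto
      then show ?case unfolding key[OF elim] by simp
    qed
    ultimately have "((\<lambda>z. (g z - g z1) / (z - z1)) \<longlongrightarrow> - poly (pderiv (poly S [:g z1:])) z1 / B z1) (at z1)"
      by (rule Lim_transform_eventually)
    then show ?thesis unfolding has_field_derivative_iff by blast
  qed
  then have "g holomorphic_on ball z0 r"
    by (subst holomorphic_on_open) auto
  then show thesis
    using that[OF \<open>r > 0\<close> \<epsilon>(1)] uniq g by blast
qed

text \<open>
  Continuity keeps u on the branch of the root that passes through the given point.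
\<close>

lemma algebraic_function_extends:
  fixes u :: "real \<Rightarrow> complex"
  assumes c: "c \<noteq> 0" "lead_coeff S = [:c:]"
    and root: "\<And>\<theta>. eval2 S (cis \<theta>) (u \<theta>) = 0"
    and simple: "eval2 (pderiv S) (cis \<theta>0) (u \<theta>0) \<noteq> 0"
    and cont: "isCont u \<theta>0"
  obtains r G where "r > 0" "G holomorphic_on ball (of_real \<theta>0) r"
    "\<And>\<theta>. \<bar>\<theta> - \<theta>0\<bar> < r \<Longrightarrow> u \<theta> = G (of_real \<theta>)"
proof -
  obtain r1 \<epsilon> g where g: "r1 > 0" "\<epsilon> > 0" "g holomorphic_on ball (cis \<theta>0) r1"
    "\<forall>z\<in>ball (cis \<theta>0) r1. \<forall>w\<in>ball (u \<theta>0) \<epsilon>. eval2 S z w = 0 \<longrightarrow> w = g z"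
    using holomorphic_simple_root[OF c root simple] by blast
  let ?e = "\<lambda>\<zeta>. exp (\<i> * \<zeta>)"
  have e: "?e (of_real \<theta>) = cis \<theta>" for \<theta> by (simp add: cis_conv_exp)
  have "isCont ?e (of_real \<theta>0)" by (intro continuous_intros)
  then obtain r2 where r2: "r2 > 0" "\<And>\<zeta>. dist \<zeta> (of_real \<theta>0) < r2 \<Longrightarrow> dist (?e \<zeta>) (?e (of_real \<theta>0)) < r1"
    using g(1) unfolding continuous_at_eps_delta by blast
  obtain r3 where r3: "r3 > 0" "\<And>\<theta>. dist \<theta> \<theta>0 < r3 \<Longrightarrow> dist (u \<theta>) (u \<theta>0) < \<epsilon>"
    using cont g(2) unfolding continuous_at_eps_delta by blast
  define r where "r = min r2 r3"
  have sub: "?e \<zeta> \<in> ball (cis \<theta>0) r1" if "\<zeta> \<in> ball (of_real \<theta>0) r" for \<zeta>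
    using r2(2)[of \<zeta>] that by (simp add: r_def dist_commute e)
  show thesis
  proof (rule that)
    show "r > 0" using r2(1) r3(1) by (simp add: r_def)
    have "(g \<circ> ?e) holomorphic_on ball (of_real \<theta>0) r"
      by (rule holomorphic_on_compose_gen[OF _ g(3)]) (use sub in \<open>auto intro!: holomorphic_intros\<close>)
    then show "(\<lambda>\<zeta>. g (?e \<zeta>)) holomorphic_on ball (of_real \<theta>0) r" by (simp add: o_def)
    fix \<theta> assume \<theta>: "\<bar>\<theta> - \<theta>0\<bar> < r"
    have "cis \<theta> \<in> ball (cis \<theta>0) r1"
      using sub[of "of_real \<theta>"] \<theta> unfolding e
      by (simp add: dist_norm of_real_diff[symmetric] abs_minus_commute del: of_real_diff)
    moreover have "u \<theta> \<in> ball (u \<theta>0) \<epsilon>"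
      using r3(2)[of \<theta>] \<theta> by (simp add: r_def dist_real_def dist_commute)
    ultimately have "u \<theta> = g (cis \<theta>)" using g(4) root by blast
    then show "u \<theta> = g (?e (of_real \<theta>))" by (simp only: e)
  qed
qed

text \<open>
  The Taylor series of a local holomorphic extension is the required power series.
\<close>

lemma real_analytic_onI:
  fixes f :: "real \<Rightarrow> complex"
  assumes "\<And>t. t \<in> I \<Longrightarrow> \<exists>r>0. \<exists>G. G holomorphic_on ball (of_real t) r \<and>
      (\<forall>s\<in>I. \<bar>s - t\<bar> < r \<longrightarrow> f s = G (of_real s))"
  shows "real_analytic_on f I"
  unfolding real_analytic_on_def
proof
  fix t assume "t \<in> I"
  then obtain r G where r: "r > 0" and G: "G holomorphic_on ball (of_real t) r"
    and f: "\<And>s. s \<in> I \<Longrightarrow> \<bar>s - t\<bar> < r \<Longrightarrow> f s = G (of_real s)"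
    using assms by blast
  define a where "a = (\<lambda>m. (deriv ^^ m) G (of_real t) / fact m)"
  have "(\<lambda>m. (s - t) ^ m *\<^sub>R a m) sums f s" if s: "s \<in> I" "\<bar>s - t\<bar> < r" for s
  proof -
    have "complex_of_real s \<in> ball (of_real t) r"
      using s(2) by (simp add: dist_norm of_real_diff[symmetric] abs_minus_commute del: of_real_diff)
    from holomorphic_power_series[OF G this]
    have "(\<lambda>m. a m * (of_real s - of_real t) ^ m) sums G (of_real s)" by (simp add: a_def)
    then show ?thesis
      unfolding f[OF s] by (simp add: scaleR_conv_of_real mult.commute)
  qed
  then show "\<exists>r>0. \<exists>a. \<forall>s\<in>I. \<bar>s - t\<bar> < r \<longrightarrow> (\<lambda>m. (s - t) ^ m *\<^sub>R a m) sums f s"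
    using r by blast
qed

section \<open>Support functions and faces of plane convex sets\<close>

definition support_fun :: "complex set \<Rightarrow> real \<Rightarrow> real" where
  "support_fun W \<theta> = (SUP w\<in>W. Re (cis (- \<theta>) * w))"

text \<open>
  The part of W on the supporting line with outer normal cis \<theta>.
\<close>

definition face :: "complex set \<Rightarrow> real \<Rightarrow> complex set" where
  "face W \<theta> = {w \<in> W. Re (cis (- \<theta>) * w) = support_fun W \<theta>}"

lemma support_fun_attained:
  assumes "compact W" "W \<noteq> {}"
  obtains w where "w \<in> W" "Re (cis (- \<theta>) * w) = support_fun W \<theta>"
    "\<forall>v\<in>W. Re (cis (- \<theta>) * v) \<le> support_fun W \<theta>"
proof -
  have "continuous_on W (\<lambda>w. Re (cis (- \<theta>) * w))" by (intro continuous_intros)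
  then obtain w where w: "w \<in> W" "\<forall>v\<in>W. Re (cis (- \<theta>) * v) \<le> Re (cis (- \<theta>) * w)"
    using continuous_attains_sup[OF assms] by blast
  then have "support_fun W \<theta> = Re (cis (- \<theta>) * w)"
    unfolding support_fun_def by (intro cSup_eq_maximum) auto
  then show thesis using that w by simp
qed

lemma support_fun_upper:
  assumes "compact W" "w \<in> W"
  shows "Re (cis (- \<theta>) * w) \<le> support_fun W \<theta>"
  using support_fun_attained[of W \<theta>] assms by (metis empty_iff)

lemma isCont_support_fun:
  assumes W: "compact W" "W \<noteq> {}"
  shows "isCont (support_fun W) \<theta>"
proof -
  obtain R where R: "\<forall>w\<in>W. cmod w \<le> R" using compact_imp_bounded[OF W(1)] bounded_iff by blast
  have le: "support_fun W \<theta> - support_fun W \<phi> \<le> cmod (cis (- \<theta>) - cis (- \<phi>)) * R" for \<theta> \<phi>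
  proof -
    obtain w where w: "w \<in> W" "Re (cis (- \<theta>) * w) = support_fun W \<theta>"
      using support_fun_attained[OF W] by blast
    have "support_fun W \<theta> - support_fun W \<phi> \<le> Re (cis (- \<theta>) * w) - Re (cis (- \<phi>) * w)"
      using w support_fun_upper[OF W(1) w(1), of \<phi>] by simp
    also have "\<dots> = Re ((cis (- \<theta>) - cis (- \<phi>)) * w)" by (simp add: algebra_simps)
    also have "\<dots> \<le> cmod ((cis (- \<theta>) - cis (- \<phi>)) * w)" by (rule complex_Re_le_cmod)
    also have "\<dots> \<le> cmod (cis (- \<theta>) - cis (- \<phi>)) * R"
      unfolding norm_mult using R w(1) by (intro mult_left_mono) auto
    finally show ?thesis .
  qed
  have "((\<lambda>\<phi>. cmod (cis (- \<phi>) - cis (- \<theta>)) * R) \<longlongrightarrow> cmod (cis (- \<theta>) - cis (- \<theta>)) * R) (at \<theta>)"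
    unfolding cis_conv_exp by (intro tendsto_intros)
  then have "((\<lambda>\<phi>. cmod (cis (- \<phi>) - cis (- \<theta>)) * R) \<longlongrightarrow> 0) (at \<theta>)" by simp
  moreover have "\<forall>\<^sub>F \<phi> in at \<theta>. norm (support_fun W \<phi> - support_fun W \<theta>) \<le> cmod (cis (- \<phi>) - cis (- \<theta>)) * R"
  proof (rule always_eventually, rule allI)
    fix \<phi>
    show "norm (support_fun W \<phi> - support_fun W \<theta>) \<le> cmod (cis (- \<phi>) - cis (- \<theta>)) * R"
      using le[of \<phi> \<theta>] le[of \<theta> \<phi>] by (simp add: norm_minus_commute[of "cis (- \<theta>)"])
  qed
  ultimately have "((\<lambda>\<phi>. support_fun W \<phi> - support_fun W \<theta>) \<longlongrightarrow> 0) (at \<theta>)"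
    by (rule Lim_null_comparison[rotated])
  then show ?thesis by (simp add: isCont_def LIM_zero_iff)
qed

lemma Re_cis_mult: "Re (cis (- \<theta>) * w) = inner (cis \<theta>) w"
  by (simp add: inner_complex_def)

lemma face_subset_frontier: "face W \<theta> \<subseteq> frontier W" if W: "compact W"
proof
  fix w assume "w \<in> face W \<theta>"
  then have w: "w \<in> W" "Re (cis (- \<theta>) * w) = support_fun W \<theta>" by (auto simp: face_def)
  have "w \<notin> interior W"
  proof
    assume "w \<in> interior W"
    then obtain e where e: "e > 0" "ball w e \<subseteq> W" using mem_interior by blast
    have "w + of_real (e / 2) * cis \<theta> \<in> W"
      using e by (intro subsetD[OF e(2)]) (simp add: dist_norm norm_mult)
    from support_fun_upper[OF W this, of \<theta>]
    have "Re (cis (- \<theta>) * w) + Re (of_real (e / 2) * (cis (- \<theta>) * cis \<theta>)) \<le> support_fun W \<theta>"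
      by (simp only: distrib_left mult.left_commute plus_complex.sel)
    then have "Re (of_real (e / 2) * (cis (- \<theta>) * cis \<theta>)) \<le> 0" using w(2) by simp
    then show False using e(1) unfolding cis_mult by simp
  qed
  then show "w \<in> frontier W" unfolding frontier_def using w(1) closure_subset by blast
qed

text \<open>
  A boundary point lies on a supporting line, whose outer unit normal is cis \<theta> for some angle. When
  W has empty interior it lies in a line, and a normal of that line serves.
\<close>

lemma frontier_eq_Union_faces:
  assumes W: "compact W" "convex W"
  shows "frontier W = (\<Union>\<theta>\<in>{0..2 * pi}. face W \<theta>)"
proof
  show "(\<Union>\<theta>\<in>{0..2 * pi}. face W \<theta>) \<subseteq> frontier W" using face_subset_frontier[OF W(1)] by blast
  show "frontier W \<subseteq> (\<Union>\<theta>\<in>{0..2 * pi}. face W \<theta>)"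
  proof
    fix w assume w: "w \<in> frontier W"
    have wW: "w \<in> W" using w compact_imp_closed[OF W(1)] by (simp add: frontier_def)
    obtain a where a: "a \<noteq> 0" "\<forall>y\<in>W. inner a w \<le> inner a y"
    proof (cases "interior W = {}")
      case True
      then obtain a b where a: "a \<noteq> 0" and b: "W \<subseteq> {x. inner a x = b}"
        using empty_interior_subset_hyperplane[OF W(2)] by blast
      have "inner a y = b" if "y \<in> W" for y using b that by blast
      then have "\<forall>y\<in>W. inner a w \<le> inner a y" using wW by simp
      with a show ?thesis by (rule that)
    next
      case False
      then have "w \<notin> rel_interior W"
        using w rel_interior_nonempty_interior[of W] by (simp add: frontier_def)
      then show ?thesis
        using supporting_hyperplane_rel_boundary[OF W(2) wW, of thesis] that by blast
    qed
    define \<rho> where "\<rho> = cmod a"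
    have \<rho>: "\<rho> > 0" using a(1) by (simp add: \<rho>_def)
    have "cmod (- a / of_real \<rho>) = 1" using a(1) by (simp add: \<rho>_def norm_divide)
    then obtain \<theta> where \<theta>: "0 \<le> \<theta>" "\<theta> < 2 * pi" "- a / of_real \<rho> = Complex (cos \<theta>) (sin \<theta>)"
      using complex_unimodular_polar by metis
    then have "- a = of_real \<rho> * cis \<theta>"
      using \<rho> by (simp add: cis.code divide_simps mult.commute)
    then have "a = - (\<rho> *\<^sub>R cis \<theta>)"
      unfolding scaleR_conv_of_real by (metis minus_minus)
    then have "inner a y = - (\<rho> * Re (cis (- \<theta>) * y))" for y
      unfolding Re_cis_mult by simp
    then have "\<forall>y\<in>W. Re (cis (- \<theta>) * y) \<le> Re (cis (- \<theta>) * w)"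
      using a(2) \<rho> by simp
    then have "support_fun W \<theta> = Re (cis (- \<theta>) * w)"
      unfolding support_fun_def using wW by (intro cSup_eq_maximum) auto
    then have "w \<in> face W \<theta>" using wW by (simp add: face_def)
    then show "w \<in> (\<Union>\<theta>\<in>{0..2 * pi}. face W \<theta>)" using \<theta> by auto
  qed
qed

lemma line_segment_face:
  assumes W: "compact W" "convex W" "W \<noteq> {}"
  shows "line_segment (face W \<theta>)"
proof -
  let ?F = "face W \<theta>" and ?h = "support_fun W \<theta>"
  let ?T = "(\<lambda>w. Im (cis (- \<theta>) * w)) ` ?F"
  have F: "?F = W \<inter> {w. inner (cis \<theta>) w = ?h}"
    unfolding face_def Re_cis_mult by blast
  have "compact ?F"
    unfolding F using W(1) closed_hyperplane by (rule compact_Int_closed)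
  moreover have "convex ?F"
    unfolding F using W(2) convex_hyperplane by (rule convex_Int)
  moreover have "continuous_on ?F (\<lambda>w. Im (cis (- \<theta>) * w))" by (intro continuous_intros)
  ultimately have "compact ?T" "connected ?T"
    using compact_continuous_image connected_continuous_image convex_connected by blast+
  moreover have "?T \<noteq> {}"
    using support_fun_attained[OF W(1,3), of \<theta>] unfolding face_def by blast
  ultimately obtain a b where ab: "?T = {a..b}" "a \<le> b"
    by (metis connected_compact_interval_1 atLeastatMost_empty_iff)
  define L where "L = (\<lambda>y::real. y *\<^sub>R (cis \<theta> * \<i>))"
  define p where "p = cis \<theta> * of_real ?h"
  have w: "w = p + L (Im (cis (- \<theta>) * w))" if "w \<in> ?F" for w
  proof -
    have "cis (- \<theta>) * w = of_real ?h + \<i> * of_real (Im (cis (- \<theta>) * w))"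
      using that unfolding face_def by (metis (mono_tags, lifting) complex_eq mem_Collect_eq)
    then have 1: "cis \<theta> * (cis (- \<theta>) * w) = cis \<theta> * (of_real ?h + \<i> * of_real (Im (cis (- \<theta>) * w)))"
      by (rule arg_cong)
    have "w = cis \<theta> * (cis (- \<theta>) * w)"
      by (simp add: mult.assoc[symmetric] cis_mult)
    also note 1
    also have "cis \<theta> * (of_real ?h + \<i> * of_real (Im (cis (- \<theta>) * w))) = p + L (Im (cis (- \<theta>) * w))"
      unfolding p_def L_def scaleR_conv_of_real by (simp only: distrib_left mult_ac)
    finally show ?thesis .
  qed
  have "(\<lambda>w. p + L (Im (cis (- \<theta>) * w))) ` ?F = (\<lambda>w. w) ` ?F"
    by (rule image_cong[OF refl]) (erule w[symmetric])
  then have "?F = (\<lambda>y. p + L y) ` ?T" unfolding image_image image_ident by (rule sym)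
  also have "\<dots> = (+) p ` (L ` closed_segment a b)"
    unfolding ab(1) closed_segment_eq_real_ivl1[OF ab(2)] image_image ..
  also have "linear L" unfolding L_def by (rule linear_scaleR_left)
  then have "(+) p ` (L ` closed_segment a b) = closed_segment (p + L a) (p + L b)"
    by (simp add: closed_segment_linear_image closed_segment_translation)
  finally show ?thesis unfolding line_segment_def by blast
qed

text \<open>
  A point w of the face makes the difference between the support function and the support function of
  {w} minimal at \<theta>. The derivative of the difference vanishes there, which determines the component
  of w along the supporting line.
\<close>

lemma face_of_differentiable:
  assumes W: "compact W" "W \<noteq> {}" and d: "(support_fun W has_real_derivative d) (at \<theta>)"
  shows "face W \<theta> = {cis \<theta> * (of_real (support_fun W \<theta>) + \<i> * of_real d)}"
proof -
  have "w = cis \<theta> * (of_real (support_fun W \<theta>) + \<i> * of_real d)" if w: "w \<in> face W \<theta>" for w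
  proof -
    have wW: "w \<in> W" and wh: "Re (cis (- \<theta>) * w) = support_fun W \<theta>" using w by (auto simp: face_def)
    let ?g = "\<lambda>\<phi>. support_fun W \<phi> - (cos \<phi> * Re w + sin \<phi> * Im w)"
    have "(?g has_real_derivative d - (- sin \<theta> * Re w + cos \<theta> * Im w)) (at \<theta>)"
      by (auto intro!: derivative_eq_intros d)
    moreover have "?g \<theta> \<le> ?g \<phi>" for \<phi>
      using support_fun_upper[OF W(1) wW, of \<phi>] wh by simp
    ultimately have "d - (- sin \<theta> * Re w + cos \<theta> * Im w) = 0"
      by (intro DERIV_local_min[where d = 1]) auto
    then have "Im (cis (- \<theta>) * w) = d" by simp
    then have "cis (- \<theta>) * w = of_real (support_fun W \<theta>) + \<i> * of_real d"
      using wh by (simp add: complex_eq_iff)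
    then have "cis \<theta> * (cis (- \<theta>) * w) = cis \<theta> * (of_real (support_fun W \<theta>) + \<i> * of_real d)"
      by simp
    then show ?thesis by (simp add: mult.assoc[symmetric] cis_mult)
  qed
  moreover have "face W \<theta> \<noteq> {}"
    using support_fun_attained[OF W, of \<theta>] unfolding face_def by blast
  ultimately show ?thesis by blast
qed

text \<open>
  The extension is real on the real axis, so its complex derivative there is real too and is the
  derivative of h.
\<close>

lemma real_derivative_of_extension:
  fixes h :: "real \<Rightarrow> real"
  assumes r: "r > 0" "G holomorphic_on ball (of_real \<theta>) r"
    and hG: "\<And>\<phi>. \<bar>\<phi> - \<theta>\<bar> < r \<Longrightarrow> of_real (h \<phi>) = G (of_real \<phi>)"
    and \<phi>: "\<bar>\<phi> - \<theta>\<bar> < r"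
  shows "\<exists>d. (h has_real_derivative d) (at \<phi>) \<and> of_real d = deriv G (of_real \<phi>)"
proof -
  have "complex_of_real \<phi> \<in> ball (of_real \<theta>) r"
    using \<phi> by (simp add: dist_norm of_real_diff[symmetric] abs_minus_commute del: of_real_diff)
  then have "DERIV G (of_real \<phi>) :> deriv G (of_real \<phi>)"
    using r(2) by (intro holomorphic_derivI) auto
  then have "((\<lambda>x. G (of_real x)) has_vector_derivative deriv G (of_real \<phi>)) (at \<phi>)"
    by (rule has_vector_derivative_real_field)
  then have D: "((\<lambda>x. complex_of_real (h x)) has_vector_derivative deriv G (of_real \<phi>)) (at \<phi>)"
  proof (rule has_vector_derivative_transform_within_open)
    show "open (ball \<theta> r)" by simp
    show "\<phi> \<in> ball \<theta> r" using \<phi> by (simp add: dist_real_def abs_minus_commute)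
    show "G (of_real x) = of_real (h x)" if "x \<in> ball \<theta> r" for x
      by (rule hG[symmetric]) (use that in \<open>simp add: dist_real_def abs_minus_commute\<close>)
  qed
  have "((\<lambda>x. Re (complex_of_real (h x))) has_vector_derivative Re (deriv G (of_real \<phi>))) (at \<phi>)"
    by (rule bounded_linear.has_vector_derivative[OF bounded_linear_Re D])
  then have 1: "(h has_real_derivative Re (deriv G (of_real \<phi>))) (at \<phi>)"
    by (simp add: has_real_derivative_iff_has_vector_derivative)
  have "((\<lambda>x. Im (complex_of_real (h x))) has_vector_derivative Im (deriv G (of_real \<phi>))) (at \<phi>)"
    by (rule bounded_linear.has_vector_derivative[OF bounded_linear_Im D])
  then have "((\<lambda>x. 0::real) has_vector_derivative Im (deriv G (of_real \<phi>))) (at \<phi>)" by simp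
  then have "Im (deriv G (of_real \<phi>)) = 0"
    by (rule vector_derivative_unique_at[OF _ has_vector_derivative_const])
  then show ?thesis using 1 by (intro exI[of _ "Re (deriv G (of_real \<phi>))"]) (simp add: complex_eq_iff)
qed

section \<open>Plane convex sets with piecewise analytic support function\<close>

lemma open_interval_minus_finite:
  fixes E :: "real set"
  assumes "finite E"
  shows "\<exists>\<I>. finite \<I> \<and> (\<forall>I\<in>\<I>. is_interval I) \<and> \<Union>\<I> = {a<..<b} - E"
  using assms
proof (induction E rule: finite_induct)
  case empty
  show ?case by (intro exI[of _ "{{a<..<b}}"]) (simp add: is_interval_oo)
next
  case (insert e E)
  then obtain \<I> where \<I>: "finite \<I>" "\<forall>I\<in>\<I>. is_interval I" "\<Union>\<I> = {a<..<b} - E"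
    by blast
  let ?J = "(\<lambda>I. I \<inter> {..<e}) ` \<I> \<union> (\<lambda>I. I \<inter> {e<..}) ` \<I>"
  have "finite ?J" using \<I>(1) by simp
  moreover have "\<forall>I\<in>?J. is_interval I"
    using \<I>(2) is_interval_Int is_interval_io is_interval_oi by blast
  moreover have "\<Union>?J = \<Union>\<I> - {e}" by auto
  then have "\<Union>?J = {a<..<b} - insert e E" unfolding \<I>(3) by blast
  ultimately show ?case by (intro exI[of _ ?J] conjI)
qed

text \<open>
  On the intervals between exceptional angles every face is the point f \<theta>, and f has the
  holomorphic extension exp (\<i> * \<zeta>) * (G \<zeta> + \<i> * deriv G \<zeta>). If the image of f contained a segment,
  the face at its midpoint would contain both endpoints. The angles 0 and 2 * pi are treated as exceptional, so that only open intervals have to carry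
  analytic parametrisations.
\<close>

lemma boundary_of_piecewise_analytic_support:
  assumes W: "compact W" "convex W" "W \<noteq> {}" and E: "finite E"
    and ext: "\<And>\<theta>. \<theta> \<in> {0<..<2 * pi} - E \<Longrightarrow> \<exists>r>0. \<exists>G. G holomorphic_on ball (of_real \<theta>) r \<and>
       (\<forall>\<phi>. \<bar>\<phi> - \<theta>\<bar> < r \<longrightarrow> complex_of_real (support_fun W \<phi>) = G (of_real \<phi>))"
  shows "\<exists>\<A>. finite \<A> \<and> (\<forall>S\<in>\<A>. line_segment S \<or> curved_real_analytic_arc S) \<and> frontier W = \<Union>\<A>"
proof -
  let ?h = "support_fun W"
  define f where "f = (\<lambda>\<theta>. cis \<theta> * (complex_of_real (?h \<theta>) + \<i> * of_real (deriv ?h \<theta>)))"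
  obtain \<I> where \<I>: "finite \<I>" "\<forall>I\<in>\<I>. is_interval I" "\<Union>\<I> = {0<..<2 * pi} - E"
    using open_interval_minus_finite[OF E, of 0 "2 * pi"] by blast
  have face: "face W \<theta> = {f \<theta>}" if \<theta>: "\<theta> \<in> {0<..<2 * pi} - E" for \<theta>
  proof -
    obtain r G where "r > 0" "G holomorphic_on ball (of_real \<theta>) r"
      "\<And>\<phi>. \<bar>\<phi> - \<theta>\<bar> < r \<Longrightarrow> complex_of_real (?h \<phi>) = G (of_real \<phi>)"
      using ext[OF \<theta>] by blast
    then obtain d where d: "(?h has_real_derivative d) (at \<theta>)"
      using real_derivative_of_extension[of r G \<theta> ?h \<theta>] by auto
    then show ?thesis
      unfolding f_def face_of_differentiable[OF W(1,3) d] using DERIV_imp_deriv[OF d] by simp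
  qed
  have analytic: "real_analytic_on f ({0<..<2 * pi} - E)"
  proof (rule real_analytic_onI)
    fix t assume t: "t \<in> {0<..<2 * pi} - E"
    obtain r G where r: "r > 0" and G: "G holomorphic_on ball (of_real t) r"
      and hG: "\<And>\<phi>. \<bar>\<phi> - t\<bar> < r \<Longrightarrow> complex_of_real (?h \<phi>) = G (of_real \<phi>)"
      using ext[OF t] by blast
    let ?K = "\<lambda>\<zeta>. exp (\<i> * \<zeta>) * (G \<zeta> + \<i> * deriv G \<zeta>)"
    have "?K holomorphic_on ball (of_real t) r"
      using G by (intro holomorphic_intros holomorphic_deriv) auto
    moreover have "f s = ?K (of_real s)" if s: "\<bar>s - t\<bar> < r" for s
    proof -
      obtain d where d: "(?h has_real_derivative d) (at s)" "of_real d = deriv G (of_real s)"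
        using real_derivative_of_extension[OF r G hG s] by blast
      show ?thesis
        unfolding f_def DERIV_imp_deriv[OF d(1)] d(2) hG[OF s] by (simp add: cis_conv_exp)
    qed
    ultimately show "\<exists>r>0. \<exists>G. G holomorphic_on ball (of_real t) r \<and>
      (\<forall>s\<in>{0<..<2 * pi} - E. \<bar>s - t\<bar> < r \<longrightarrow> f s = G (of_real s))"
      using r by (intro exI[of _ r] conjI exI[of _ ?K]) auto
  qed
  have no_segment: "\<not> closed_segment a b \<subseteq> f ` I" if "I \<in> \<I>" "a \<noteq> b" for I a b
  proof
    assume sub: "closed_segment a b \<subseteq> f ` I"
    have I: "I \<subseteq> {0<..<2 * pi} - E" using that(1) \<I>(3) by blast
    have "f ` I \<subseteq> W"
    proof
      fix w assume "w \<in> f ` I"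
      then obtain s where "s \<in> I" "w = f s" by blast
      then have "w \<in> face W s" using face[of s] I by blast
      then show "w \<in> W" by (simp add: face_def)
    qed
    then have W': "closed_segment a b \<subseteq> W" using sub by (rule subset_trans[rotated])
    have aW: "a \<in> W" and bW: "b \<in> W"
      by (rule subsetD[OF W'], rule ends_in_segment)+
    have "midpoint a b \<in> f ` I" by (rule subsetD[OF sub]) simp
    then obtain \<theta> where \<theta>: "\<theta> \<in> I" "midpoint a b = f \<theta>" by blast
    have F: "face W \<theta> = {midpoint a b}"
      unfolding \<theta>(2) by (rule face) (use \<theta>(1) I in blast)
    then have "midpoint a b \<in> face W \<theta>" by simp
    then have "inner (cis \<theta>) (midpoint a b) = ?h \<theta>"
      unfolding face_def Re_cis_mult by simp
    then have "inner (cis \<theta>) a + inner (cis \<theta>) b = 2 * ?h \<theta>"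
      by (simp add: midpoint_def inner_add_right inner_scaleR_right)
    moreover have "inner (cis \<theta>) a \<le> ?h \<theta>" "inner (cis \<theta>) b \<le> ?h \<theta>"
      using support_fun_upper[OF W(1) aW, of \<theta>] support_fun_upper[OF W(1) bW, of \<theta>]
      unfolding Re_cis_mult by auto
    ultimately have "a \<in> face W \<theta>" "b \<in> face W \<theta>"
      unfolding face_def Re_cis_mult using aW bW by auto
    then have "a = midpoint a b" "b = midpoint a b" unfolding F singleton_iff .
    then show False using that(2) by metis
  qed
  let ?A = "face W ` ((E \<inter> {0..2 * pi}) \<union> {0, 2 * pi}) \<union> (\<lambda>I. f ` I) ` (\<I> - {{}})"
  have fin: "finite ?A" using E \<I>(1) by simp
  have seg: "line_segment S \<or> curved_real_analytic_arc S" if S: "S \<in> ?A" for S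
  proof (cases "S \<in> face W ` ((E \<inter> {0..2 * pi}) \<union> {0, 2 * pi})")
    case True
    then show ?thesis using line_segment_face[OF W] by blast
  next
    case False
    then obtain I where I: "I \<in> \<I>" "I \<noteq> {}" "S = f ` I" using S by blast
    show ?thesis
    proof (cases "f constant_on I")
      case True
      then obtain y where "\<forall>t\<in>I. f t = y" unfolding constant_on_def by blast
      then have "S = closed_segment y y" using I(2,3) by auto
      then show ?thesis unfolding line_segment_def by blast
    next
      case False
      have "I \<subseteq> {0<..<2 * pi} - E" using I(1) \<I>(3) by blast
      then have "real_analytic_on f I"
        using analytic unfolding real_analytic_on_def by (meson subsetD)
      then have "curved_real_analytic_arc S"
        unfolding curved_real_analytic_arc_def using False I \<I>(2) no_segment[OF I(1)] by blast
      then show ?thesis ..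
    qed
  qed
  have fr: "frontier W = \<Union>?A"
  proof -
    have "frontier W = (\<Union>\<theta>\<in>{0..2 * pi}. face W \<theta>)" by (rule frontier_eq_Union_faces[OF W(1,2)])
    also have "{0..2 * pi} = ((E \<inter> {0..2 * pi}) \<union> {0, 2 * pi}) \<union> ({0<..<2 * pi} - E)"
      by auto
    also have "(\<Union>\<theta>\<in>\<dots>. face W \<theta>) = \<Union>(face W ` ((E \<inter> {0..2 * pi}) \<union> {0, 2 * pi}))
        \<union> (\<Union>\<theta>\<in>{0<..<2 * pi} - E. face W \<theta>)"
      by (rule UN_Un)
    also have "(\<Union>\<theta>\<in>{0<..<2 * pi} - E. face W \<theta>) = (\<Union>\<theta>\<in>{0<..<2 * pi} - E. {f \<theta>})"
      by (rule SUP_cong[OF refl face])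
    also have "\<dots> = f ` (\<Union>\<I>)" unfolding \<I>(3) by blast
    also have "\<dots> = \<Union>((\<lambda>I. f ` I) ` (\<I> - {{}}))" by blast
    finally show ?thesis by (simp only: Union_Un_distrib)
  qed
  show ?thesis by (intro exI[of _ ?A] conjI ballI fin seg fr)
qed

section \<open>The support function of the numerical range\<close>

text \<open>
  The tensor product of eigenvectors u 0, ..., u (k-1) of N, with entries indexed by functions f, is an
  eigenvector of the Kronecker sum of k copies of N for the sum of the eigenvalues. An entry of the
  i-th summand is nonzero only if f and g agree off i.
\<close>

lemma kronecker_sum_eigenvector:
  fixes N :: "nat \<Rightarrow> nat \<Rightarrow> complex" and k n :: nat
  assumes ev: "\<And>i p. i < k \<Longrightarrow> p < n \<Longrightarrow> (\<Sum>q<n. N p q * u i q) = lam i * u i p"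
    and f: "f \<in> {..<k} \<rightarrow>\<^sub>E {..<n}"
  shows "(\<Sum>g\<in>{..<k} \<rightarrow>\<^sub>E {..<n}. (\<Sum>i<k. if \<forall>j<k. j \<noteq> i \<longrightarrow> f j = g j then N (f i) (g i) else 0) * (\<Prod>i<k. u i (g i)))
    = (\<Sum>i<k. lam i) * (\<Prod>i<k. u i (f i))"
proof -
  let ?I = "{..<k} \<rightarrow>\<^sub>E {..<n}"
  let ?v = "\<lambda>g. \<Prod>i<k. u i (g i)"
  let ?agree = "\<lambda>i g. \<forall>j<k. j \<noteq> i \<longrightarrow> f j = g j"
  have fin: "finite ?I" by (intro finite_PiE) auto
  have if_mult: "(if P then a else 0) * b = (if P then a * b else 0)" for P and a b :: complex
    by simp
  have one: "(\<Sum>g\<in>?I. (if ?agree i g then N (f i) (g i) else 0) * ?v g) = lam i * ?v f" if i: "i < k" for i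
  proof -
    have agree: "{g \<in> ?I. ?agree i g} = (\<lambda>q. f(i := q)) ` {..<n}"
    proof (intro equalityI subsetI)
      fix g assume g: "g \<in> {g \<in> ?I. ?agree i g}"
      have "g = f(i := g i)"
      proof
        fix j
        show "g j = (f(i := g i)) j"
        proof (cases "j < k")
          case False
          then show ?thesis using g f i by (auto simp: PiE_def extensional_def)
        qed (use g in auto)
      qed
      moreover have "g i < n" using g i by (auto simp: PiE_def Pi_def)
      ultimately show "g \<in> (\<lambda>q. f(i := q)) ` {..<n}" by blast
    next
      fix g assume "g \<in> (\<lambda>q. f(i := q)) ` {..<n}"
      then show "g \<in> {g \<in> ?I. ?agree i g}"
        using f i by (auto simp: PiE_def Pi_def extensional_def)
    qed
    have inj: "inj_on (\<lambda>q. f(i := q)) {..<n}"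
      by (rule inj_onI) (metis fun_upd_same)
    \<comment> \<open>the product over the unchanged coordinates\<close>
    define R where "R = (\<Prod>j\<in>{..<k} - {i}. u j (f j))"
    have v: "?v (f(i := q)) = u i q * R" for q
    proof -
      have "?v (f(i := q)) = u i q * (\<Prod>j\<in>{..<k} - {i}. u j ((f(i := q)) j))"
        using i by (subst prod.remove[of _ i]) auto
      also have "(\<Prod>j\<in>{..<k} - {i}. u j ((f(i := q)) j)) = R"
        unfolding R_def by (intro prod.cong) auto
      finally show ?thesis .
    qed
    have "(\<Sum>g\<in>?I. (if ?agree i g then N (f i) (g i) else 0) * ?v g)
        = (\<Sum>g\<in>?I. if ?agree i g then N (f i) (g i) * ?v g else 0)"
      by (intro sum.cong refl if_mult)
    also have "\<dots> = (\<Sum>g\<in>{g \<in> ?I. ?agree i g}. N (f i) (g i) * ?v g)"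
      by (rule sum.inter_filter[symmetric, OF fin])
    also have "\<dots> = (\<Sum>q<n. N (f i) q * (u i q * R))"
      unfolding agree sum.reindex[OF inj] by (simp only: o_def fun_upd_same v)
    also have "\<dots> = (\<Sum>q<n. N (f i) q * u i q) * R"
      by (simp add: sum_distrib_right mult.assoc)
    also have "\<dots> = lam i * (u i (f i) * R)"
      using ev[OF i, of "f i"] f i by (auto simp: PiE_def Pi_def)
    also have "u i (f i) * R = ?v f" using v[of "f i"] by simp
    finally show ?thesis .
  qed
  have "(\<Sum>g\<in>?I. (\<Sum>i<k. if ?agree i g then N (f i) (g i) else 0) * ?v g)
      = (\<Sum>i<k. \<Sum>g\<in>?I. (if ?agree i g then N (f i) (g i) else 0) * ?v g)"
    unfolding sum_distrib_right by (rule sum.swap)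
  also have "\<dots> = (\<Sum>i<k. lam i * ?v f)"
    by (intro sum.cong refl one) simp
  finally show ?thesis by (simp add: sum_distrib_right)
qed

text \<open>
  The Hermitian part of cis (-\<theta>) * A. Multiplied by cis \<theta> it becomes a polynomial in cis \<theta>.
\<close>

definition pencil :: "(nat \<Rightarrow> nat \<Rightarrow> complex) \<Rightarrow> real \<Rightarrow> nat \<Rightarrow> nat \<Rightarrow> complex" where
  "pencil A \<theta> = (\<lambda>i j. (cis (- \<theta>) * A i j + cis \<theta> * adj A i j) / 2)"

lemma adj_pencil: "adj (pencil A \<theta>) = pencil A \<theta>"
  by (simp add: pencil_def adj_def cis_cnj add.commute)

lemma Re_cip_pencil: "Re (cip n (mv n (pencil A \<theta>) x) x) = Re (cis (- \<theta>) * cip n (mv n A x) x)"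
proof -
  have "mv n (pencil A \<theta>) x = (\<lambda>i. (1 / 2) * (cis (- \<theta>) * mv n A x i + cis \<theta> * mv n (adj A) x i))"
    unfolding mv_def pencil_def sum_distrib_left sum.distrib[symmetric]
    by (intro ext sum.cong refl) (simp add: algebra_simps add_divide_distrib)
  then have "cip n (mv n (pencil A \<theta>) x) x
      = (1 / 2) * (cis (- \<theta>) * cip n (mv n A x) x + cis \<theta> * cip n (mv n (adj A) x) x)"
    by (simp only: cip_scale_left cip_add_left)
  also have "cis \<theta> * cip n (mv n (adj A) x) x = cnj (cis (- \<theta>) * cip n (mv n A x) x)"
    using cip_mv_left[of n "adj A" x x] cip_commute[of n x "mv n A x"] by (simp add: cis_cnj)
  finally have "cip n (mv n (pencil A \<theta>) x) x
      = (1 / 2) * (cis (- \<theta>) * cip n (mv n A x) x + cnj (cis (- \<theta>) * cip n (mv n A x) x))" .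
  then show ?thesis unfolding complex_add_cnj by simp
qed

text \<open>
  At each angle Ky Fan's principle supplies eigenvectors whose eigenvalues add up to k times the
  support function, and their tensor product is an eigenvector of one matrix M over \<complex>[z] that does
  not depend on the angle; F is its characteristic polynomial. The factor cis \<theta> clears the negative
  power of cis \<theta> in the pencil.
\<close>

lemma support_fun_algebraic:
  assumes k: "0 < k" "k \<le> n"
  obtains F where "lead_coeff F = 1"
    "\<forall>\<theta>. eval2 F (cis \<theta>) (cis \<theta> * of_real (real k * support_fun (numerical_range (cip n) k (mv n A)) \<theta>)) = 0"
proof -
  let ?W = "numerical_range (cip n) k (mv n A)"
  let ?I = "{..<k} \<rightarrow>\<^sub>E {..<n}"
  define N where "N = (\<lambda>p q. [:A p q / 2, 0, adj A p q / 2:])"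
  have N: "poly (N p q) (cis \<theta>) = cis \<theta> * pencil A \<theta> p q" for p q \<theta>
  proof -
    have "cis \<theta> * (cis (- \<theta>) * A p q) = A p q" by (simp add: mult.assoc[symmetric] cis_mult)
    then show ?thesis by (simp add: N_def pencil_def algebra_simps add_divide_distrib)
  qed
  define M where "M = (\<lambda>f g. \<Sum>i<k. if \<forall>j<k. j \<noteq> i \<longrightarrow> f j = g j then N (f i) (g i) else 0)"
  have "finite ?I" by (intro finite_PiE) auto
  from eigenvalue_algebraic[OF this, of M] obtain F where F: "lead_coeff F = 1"
    "\<forall>z s v. (\<exists>f\<in>?I. v f \<noteq> 0) \<longrightarrow> (\<forall>f\<in>?I. (\<Sum>g\<in>?I. poly (M f g) z * v g) = s * v f) \<longrightarrow> eval2 F z s = 0"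
    by blast
  have "eval2 F (cis \<theta>) (cis \<theta> * of_real (real k * support_fun ?W \<theta>)) = 0" for \<theta>
  proof -
    obtain u lam where u: "orthonormal_family (cip n) k u"
      and ev: "\<forall>i<k. \<forall>j<n. mv n (pencil A \<theta>) (u i) j = complex_of_real (lam i) * u i j"
      and max: "\<forall>x. orthonormal_family (cip n) k x \<longrightarrow>
         (\<Sum>i<k. Re (cip n (mv n (pencil A \<theta>) (x i)) (x i))) \<le> (\<Sum>i<k. lam i)"
      using ky_fan[OF adj_pencil[of A \<theta>] k] by blast
    have Re: "Re (cis (- \<theta>) * (1 / of_nat k * (\<Sum>i<k. cip n (mv n A (x i)) (x i))))
        = (\<Sum>i<k. Re (cip n (mv n (pencil A \<theta>) (x i)) (x i))) / real k" for x
    proof -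
      have "cis (- \<theta>) * (1 / of_nat k * (\<Sum>i<k. cip n (mv n A (x i)) (x i)))
          = (\<Sum>i<k. cis (- \<theta>) * cip n (mv n A (x i)) (x i)) / of_real (real k)"
        by (simp add: sum_distrib_left sum_divide_distrib)
      then show ?thesis unfolding Re_cip_pencil by (simp only: Re_divide_of_real Re_sum)
    qed
    have sum_u: "(\<Sum>i<k. Re (cip n (mv n (pencil A \<theta>) (u i)) (u i))) = (\<Sum>i<k. lam i)"
    proof (intro sum.cong refl)
      fix i assume "i \<in> {..<k}"
      then show "Re (cip n (mv n (pencil A \<theta>) (u i)) (u i)) = lam i"
        using cip_eigenvector_left[of n "pencil A \<theta>" "u i" "of_real (lam i)" "u i"] ev u
        by (simp add: orthonormal_family_def)
    qed
    have "support_fun ?W \<theta> = (\<Sum>i<k. lam i) / real k"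
      unfolding support_fun_def
    proof (rule cSup_eq_maximum)
      have "1 / of_nat k * (\<Sum>i<k. cip n (mv n A (u i)) (u i)) \<in> ?W"
        unfolding numerical_range_def using u by blast
      then show "(\<Sum>i<k. lam i) / real k \<in> (\<lambda>w. Re (cis (- \<theta>) * w)) ` ?W"
        using Re[of u] sum_u by (intro image_eqI) auto
      fix y assume "y \<in> (\<lambda>w. Re (cis (- \<theta>) * w)) ` ?W"
      then obtain x where x: "orthonormal_family (cip n) k x"
        and y: "y = Re (cis (- \<theta>) * (1 / of_nat k * (\<Sum>i<k. cip n (mv n A (x i)) (x i))))"
        unfolding numerical_range_def by blast
      show "y \<le> (\<Sum>i<k. lam i) / real k"
        unfolding y Re by (intro divide_right_mono max[rule_format, OF x]) simp
    qed
    then have "real k * support_fun ?W \<theta> = (\<Sum>i<k. lam i)"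
      using k(1) by simp
    then have s: "cis \<theta> * of_real (real k * support_fun ?W \<theta>) = (\<Sum>i<k. cis \<theta> * of_real (lam i))"
      by (simp only: of_real_sum sum_distrib_left)
    define v where "v = (\<lambda>f. \<Prod>i<k. u i (f i))"
    have "\<exists>f\<in>?I. v f \<noteq> 0"
    proof -
      have "\<exists>q<n. u i q \<noteq> 0" if "i < k" for i
      proof -
        have "cip n (u i) (u i) \<noteq> 0" using u that by (simp add: orthonormal_family_def)
        then show ?thesis by (simp add: cip_self_eq_0_iff)
      qed
      then obtain q where q: "\<And>i. i < k \<Longrightarrow> q i < n \<and> u i (q i) \<noteq> 0" by metis
      show ?thesis
        by (rule bexI[of _ "restrict q {..<k}"]) (use q in \<open>auto simp: v_def\<close>)
    qed
    moreover have "\<forall>f\<in>?I. (\<Sum>g\<in>?I. poly (M f g) (cis \<theta>) * v g) = (\<Sum>i<k. cis \<theta> * of_real (lam i)) * v f"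
    proof
      fix f assume f: "f \<in> ?I"
      have ev': "(\<Sum>q<n. cis \<theta> * pencil A \<theta> p q * u i q) = cis \<theta> * of_real (lam i) * u i p" if "i < k" "p < n" for i p
        using ev that by (simp add: mv_def sum_distrib_left[symmetric] mult.assoc)
      have poly_if: "poly (if P then p else 0) z = (if P then poly p z else 0)" for P p and z :: complex
        by simp
      note * = kronecker_sum_eigenvector[where N = "\<lambda>p q. cis \<theta> * pencil A \<theta> p q", OF ev' f]
      have "poly (M f g) (cis \<theta>) = (\<Sum>i<k. if \<forall>j<k. j \<noteq> i \<longrightarrow> f j = g j then cis \<theta> * pencil A \<theta> (f i) (g i) else 0)" for g
        unfolding M_def poly_sum poly_if N ..
      then show "(\<Sum>g\<in>?I. poly (M f g) (cis \<theta>) * v g) = (\<Sum>i<k. cis \<theta> * of_real (lam i)) * v f"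
        unfolding v_def using * by simp
    qed
    ultimately show ?thesis unfolding s using F(2) by blast
  qed
  then show thesis using that F(1) by blast
qed

text \<open>
  The exceptional angles are those at which cis \<theta> is a zero of the polynomial D controlling multiple
  roots; these are finitely many because cis is injective on the interval.
\<close>

lemma support_fun_extends:
  assumes k: "0 < k" "k \<le> n" and "W = numerical_range (cip n) k (mv n A)" "W \<noteq> {}"
  obtains E where "finite E"
    "\<forall>\<theta>\<in>{0<..<2 * pi} - E. \<exists>r>0. \<exists>G. G holomorphic_on ball (of_real \<theta>) r \<and>
       (\<forall>\<phi>. \<bar>\<phi> - \<theta>\<bar> < r \<longrightarrow> complex_of_real (support_fun W \<phi>) = G (of_real \<phi>))"
proof -
  define u where "u = (\<lambda>\<theta>. cis \<theta> * complex_of_real (real k * support_fun W \<theta>))"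
  obtain F where F: "lead_coeff F = 1" "\<forall>\<theta>. eval2 F (cis \<theta>) (u \<theta>) = 0"
    using support_fun_algebraic[OF k, of A] unfolding u_def assms(3) by blast
  define Z where "Z = range (\<lambda>\<theta>. (cis \<theta>, u \<theta>))"
  have van: "\<forall>(z, w)\<in>Z. eval2 F z w = 0" using F(2) by (auto simp: Z_def)
  obtain S c D where
    c: "c \<noteq> 0" "lead_coeff S = [:c:]" and S: "\<forall>(z, w)\<in>Z. eval2 S z w = 0" and "D \<noteq> 0"
    and D: "\<forall>z w. eval2 S z w = 0 \<longrightarrow> poly D z \<noteq> 0 \<longrightarrow> eval2 (pderiv S) z w \<noteq> 0"
    by (rule simple_root_polynomial[OF F(1) van])
  have S': "eval2 S (cis \<theta>) (u \<theta>) = 0" for \<theta> using S by (auto simp: Z_def)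
  define E where "E = {\<theta>\<in>{0<..<2 * pi}. poly D (cis \<theta>) = 0}"
  have "inj_on cis {0<..<2 * pi}"
  proof (rule inj_onI)
    fix x y assume xy: "x \<in> {0<..<2 * pi}" "y \<in> {0<..<2 * pi}" "cis x = cis y"
    then have "sin x = sin y \<and> cos x = cos y" by (simp add: complex_eq_iff)
    then obtain m :: int where m: "x = y + 2 * pi * real_of_int m" unfolding sin_cos_eq_iff by blast
    then have "2 * pi * real_of_int m < 2 * pi * 1" "2 * pi * (- 1) < 2 * pi * real_of_int m"
      using xy(1,2) unfolding greaterThanLessThan_iff by linarith+
    then have "real_of_int m < 1" "- 1 < real_of_int m"
      using pi_gt_zero by (simp_all only: mult_less_cancel_left_pos mult_pos_pos zero_less_numeral)
    then have "m = 0" by linarith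
    then show "x = y" using m by simp
  qed
  then have "finite E"
    unfolding E_def using finite_vimage_IntI[OF poly_roots_finite[OF \<open>D \<noteq> 0\<close>], of cis "{0<..<2 * pi}"]
    by (simp add: vimage_def Int_def conj_commute)
  then show thesis
  proof (rule that, intro ballI)
    fix \<theta> assume "\<theta> \<in> {0<..<2 * pi} - E"
    then have "poly D (cis \<theta>) \<noteq> 0" by (auto simp: E_def)
    then have simple: "eval2 (pderiv S) (cis \<theta>) (u \<theta>) \<noteq> 0" using D S' by blast
    have "isCont (support_fun W) \<theta>"
      using isCont_support_fun compact_numerical_range assms(3,4) by blast
    then have "isCont u \<theta>" unfolding u_def cis_conv_exp by (intro continuous_intros)
    then obtain r G where r: "r > 0" "G holomorphic_on ball (of_real \<theta>) r"
      and G: "\<And>\<phi>. \<bar>\<phi> - \<theta>\<bar> < r \<Longrightarrow> u \<phi> = G (of_real \<phi>)"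
      using algebraic_function_extends[OF c S' simple] by metis
    let ?G = "\<lambda>\<zeta>. exp (- (\<i> * \<zeta>)) * G \<zeta> / of_nat k"
    have "?G holomorphic_on ball (of_real \<theta>) r"
      using r(2) k(1) by (intro holomorphic_intros) auto
    moreover have "complex_of_real (support_fun W \<phi>) = ?G (of_real \<phi>)" if "\<bar>\<phi> - \<theta>\<bar> < r" for \<phi>
    proof -
      have "exp (- (\<i> * complex_of_real \<phi>)) * cis \<phi> = 1"
        by (simp add: cis_conv_exp exp_add[symmetric])
      then show ?thesis
        using k(1) unfolding G[OF that, symmetric] u_def
        by (simp add: mult.assoc[symmetric])
    qed
    ultimately show "\<exists>r>0. \<exists>G. G holomorphic_on ball (of_real \<theta>) r \<and>
       (\<forall>\<phi>. \<bar>\<phi> - \<theta>\<bar> < r \<longrightarrow> complex_of_real (support_fun W \<phi>) = G (of_real \<phi>))"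
      using r(1) by blast
  qed
qed

section \<open>The boundary of the numerical range\<close>

lemma numerical_range_nonempty:
  assumes "k \<le> n"
  shows "numerical_range (cip n) k (mv n A) \<noteq> {}"
proof -
  have "orthonormal_family (cip n) 0 (\<lambda>i j. 0)" by (simp add: orthonormal_family_def)
  then obtain v where "orthonormal_family (cip n) n v"
    by (rule orthonormal_extend) auto
  then have "orthonormal_family (cip n) k v"
    using assms by (simp add: orthonormal_family_def)
  then show ?thesis unfolding numerical_range_def by blast
qed

theorem theorem5p4:
  fixes scale :: "complex \<Rightarrow> 'a::ab_group_add \<Rightarrow> 'a"
    and ip :: "'a \<Rightarrow> 'a \<Rightarrow> complex"
    and c :: "'a \<Rightarrow> 'a"
    and n k :: nat
  assumes "fin_dim_complex_hilbert_space scale ip"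
    and "vector_space.dim scale (UNIV :: 'a set) = n"
    and "Vector_Spaces.linear scale scale c"
    and "0 < k" and "k < n"
  shows "\<exists>\<A>. finite \<A> \<and>
           (\<forall>S\<in>\<A>. line_segment S \<or> curved_real_analytic_arc S) \<and>
           frontier (numerical_range ip k c) = \<Union>\<A>"
proof -
  obtain A where A: "numerical_range ip k c = numerical_range (cip n) k (mv n A)"
    by (rule fin_dim_complex_hilbert_space.numerical_range_coordinates[OF assms(1-3)])
  define W where "W = numerical_range (cip n) k (mv n A)"
  have k: "k \<le> n" using assms(5) by simp
  have W: "compact W" "convex W" "W \<noteq> {}"
    unfolding W_def
    by (rule compact_numerical_range, rule convex_numerical_range, rule numerical_range_nonempty[OF k])
  obtain E where E: "finite E"
    and ext: "\<forall>\<theta>\<in>{0<..<2 * pi} - E. \<exists>r>0. \<exists>G. G holomorphic_on ball (of_real \<theta>) r \<and>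
       (\<forall>\<phi>. \<bar>\<phi> - \<theta>\<bar> < r \<longrightarrow> complex_of_real (support_fun W \<phi>) = G (of_real \<phi>))"
    by (rule support_fun_extends[OF assms(4) k W_def W(3)])
  show ?thesis
    unfolding A W_def[symmetric]
    by (rule boundary_of_piecewise_analytic_support[OF W E]) (rule ext[rule_format])
qed

end
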